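(* Let $F_3(x,y)$ be the free commutative automorphic loop of nilpotency class $3$ on free generators $x$, $y$. Let $u_1=(x,x,y)$, $u_2=(x,y,y)$, $v_1=(x,x,u_1)$, $v_2=(x,x,u_2)$, $v_3=(y,y,u_1)$, $v_4=(y,y,u_2)$. Then each element of $F_3(x,y)$ can be written uniquely as $(x^{a_1}y^{a_2}\cdot u_1^{a_3}u_2^{a_4})v_1^{a_5}v_2^{a_6}v_3^{a_7}v_4^{a_8}$ with $a_1,\dots,a_8\in\mathbb Z$, and $F_3(x,y)$ is isomorphic to $(\mathbb Z^8,* )$, where for $a=(a_1,\dots,a_8)$, $b=(b_1,\dots,b_8)\in\mathbb Z^8$ the product $a*b=(c_1,\dots,c_8)$ is given by \begin{align*} c_1&=a_1+b_1,\qquad c_2=a_2+b_2,\\ c_3&=a_3+b_3-a_1b_1(a_2+b_2),\qquad c_4=a_4+b_4+a_2b_2(a_1+b_1),\\ c_5&=a_5+b_5+(a_2+b_2)(b_1\alpha(a_1)+a_1\alpha(b_1))+a_2(a_1\beta(b_1)+b_1^2\beta(a_1))+b_2(b_1\beta(a_1)+a_1^2\beta(b_1))-a_1b_1(a_3+b_3),\\ c_6&=a_6+b_6+2a_1a_2b_1b_2(a_1+b_1)+(a_2+b_2)(a_1\beta(b_1)+b_1\beta(a_1))+(\beta(a_2)+\beta(b_2))(a_1b_1^2+b_1a_1^2)\\ &\quad-a_2b_2\alpha(a_1+b_1)-a_1b_1(a_4+b_4)-(a_3+b_3)(a_1b_2+a_2b_1),\\ c_7&=a_7+b_7-2a_1a_2b_1b_2(a_2+b_2)-(a_1+b_1)(a_2\beta(b_2)+b_2\beta(a_2))-(\beta(a_1)+\beta(b_1))(a_2b_2^2+b_2a_2^2)\\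 &\quad+a_1b_1\alpha(a_2+b_2)-a_2b_2(a_3+b_3)-(a_4+b_4)(a_1b_2+a_2b_1),\\ c_8&=a_8+b_8-(a_1+b_1)(a_2\alpha(b_2)+b_2\alpha(a_2))-a_1(a_2\beta(b_2)+b_2^2\beta(a_2))-b_1(b_2\beta(a_2)+a_2^2\beta(b_2))-a_2b_2(a_4+b_4), \end{align*} with $\alpha(n)=(n^3-n)/3$ and $\beta(n)=n^2-n$.
   Context: A loop is a set $Q$ with a binary operation (written as juxtaposition; $\cdot$ indicates lower priority, e.g. $ab\cdot c=(ab)c$) such that all left and right translations $L_a:b\mapsto ab$, $R_a:b\mapsto ba$ are bijections and there is a two-sided identity $1$. Maps are written on the right. The inner mapping group $\mathrm{Inn}(Q)$ is the stabilizer of $1$ in the group generated by all $L_a,R_a$; it is generated by $L_{a,b}=L_aL_bL_{ba}^{-1}$, $R_{a,b}=R_aR_bR_{ab}^{-1}$, $T_a=R_aL_a^{-1}$. $Q$ is automorphic if every inner mapping is an automorphism; automorphic loops are power-associative, so powers $a^n$, $n\in\mathbb Z$, are well defined. The associator $(a,b,c)$ is the unique element with $ab\cdot c=(a\cdot bc)(a,b,c)$. The center $Z(Q)$ is the set of elements fixed by all inner mappings; $Z_0=1$, $Z_{i+1}(Q)$ is the preimage of $Z(Q/Z_i(Q))$, and $Q$ has nilpotency class $n$ if $Z_{n-1}(Q)\ne Q=Z_n(Q)$. $F_3(x,y)$ denotes the free object on $x,y$ in the variety of commutative automorphic loops of nilpotency class at most $3$. In the canonical form the elements $v_i$ are central,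 so the expression is unambiguous. *)

theory Defs
  imports Main "HOL-Library.FuncSet"
begin

definition loop :: "'a set \<Rightarrow> ('a \<Rightarrow> 'a \<Rightarrow> 'a) \<Rightarrow> 'a \<Rightarrow> bool" where
  "loop S m e \<longleftrightarrow> e \<in> S \<and>
     (\<forall>a\<in>S. m e a = a \<and> m a e = a) \<and>
     (\<forall>a\<in>S. bij_betw (\<lambda>b. m a b) S S \<and> bij_betw (\<lambda>b. m b a) S S)"

definition commutative_loop :: "'a set \<Rightarrow> ('a \<Rightarrow> 'a \<Rightarrow> 'a) \<Rightarrow> 'a \<Rightarrow> bool" where
  "commutative_loop S m e \<longleftrightarrow> loop S m e \<and> (\<forall>a\<in>S. \<forall>b\<in>S. m a b = m b a)"

inductive_set mlt :: "'a set \<Rightarrow> ('a \<Rightarrow> 'a \<Rightarrow> 'a) \<Rightarrow> ('a \<Rightarrow> 'a) set"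
  for S :: "'a set" and m :: "'a \<Rightarrow> 'a \<Rightarrow> 'a" where
  mlt_id: "restrict (\<lambda>z. z) S \<in> mlt S m"
| mlt_L: "a \<in> S \<Longrightarrow> restrict (\<lambda>z. m a z) S \<in> mlt S m"
| mlt_R: "a \<in> S \<Longrightarrow> restrict (\<lambda>z. m z a) S \<in> mlt S m"
| mlt_comp: "f \<in> mlt S m \<Longrightarrow> g \<in> mlt S m \<Longrightarrow> restrict (\<lambda>z. g (f z)) S \<in> mlt S m"
| mlt_inv: "f \<in> mlt S m \<Longrightarrow> restrict (inv_into S f) S \<in> mlt S m"

definition inn :: "'a set \<Rightarrow> ('a \<Rightarrow> 'a \<Rightarrow> 'a) \<Rightarrow> 'a \<Rightarrow> ('a \<Rightarrow> 'a) set" where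
  "inn S m e = {f \<in> mlt S m. f e = e}"

definition automorphism :: "'a set \<Rightarrow> ('a \<Rightarrow> 'a \<Rightarrow> 'a) \<Rightarrow> ('a \<Rightarrow> 'a) \<Rightarrow> bool" where
  "automorphism S m f \<longleftrightarrow> bij_betw f S S \<and> (\<forall>a\<in>S. \<forall>b\<in>S. f (m a b) = m (f a) (f b))"

definition automorphic_loop :: "'a set \<Rightarrow> ('a \<Rightarrow> 'a \<Rightarrow> 'a) \<Rightarrow> 'a \<Rightarrow> bool" where
  "automorphic_loop S m e \<longleftrightarrow> loop S m e \<and> (\<forall>f\<in>inn S m e. automorphism S m f)"

definition center :: "'a set \<Rightarrow> ('a \<Rightarrow> 'a \<Rightarrow> 'a) \<Rightarrow> 'a \<Rightarrow> 'a set" where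
  "center S m e = {a \<in> S. \<forall>f\<in>inn S m e. f a = a}"

text \<open>Cosets and quotient loop Q/N (meaningful when N is a normal subloop).\<close>

definition lcoset :: "('a \<Rightarrow> 'a \<Rightarrow> 'a) \<Rightarrow> 'a \<Rightarrow> 'a set \<Rightarrow> 'a set" where
  "lcoset m a N = (\<lambda>n. m a n) ` N"

definition quot_carrier :: "'a set \<Rightarrow> ('a \<Rightarrow> 'a \<Rightarrow> 'a) \<Rightarrow> 'a set \<Rightarrow> 'a set set" where
  "quot_carrier S m N = (\<lambda>a. lcoset m a N) ` S"

definition quot_mult :: "('a \<Rightarrow> 'a \<Rightarrow> 'a) \<Rightarrow> 'a set \<Rightarrow> 'a set \<Rightarrow> 'a set \<Rightarrow> 'a set" where
  "quot_mult m N X Y = lcoset m (m (SOME a. a \<in> X) (SOME b. b \<in> Y)) N"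

fun upper_central :: "'a set \<Rightarrow> ('a \<Rightarrow> 'a \<Rightarrow> 'a) \<Rightarrow> 'a \<Rightarrow> nat \<Rightarrow> 'a set" where
  "upper_central S m e 0 = {e}"
| "upper_central S m e (Suc i) =
     {a \<in> S. lcoset m a (upper_central S m e i) \<in>
        center (quot_carrier S m (upper_central S m e i))
               (quot_mult m (upper_central S m e i)) (upper_central S m e i)}"

definition nilpotency_class_le :: "'a set \<Rightarrow> ('a \<Rightarrow> 'a \<Rightarrow> 'a) \<Rightarrow> 'a \<Rightarrow> nat \<Rightarrow> bool" where
  "nilpotency_class_le S m e k \<longleftrightarrow> (\<exists>n\<le>k. upper_central S m e n = S)"

definition CAL3 :: "'a set \<Rightarrow> ('a \<Rightarrow> 'a \<Rightarrow> 'a) \<Rightarrow> 'a \<Rightarrow> bool" where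
  "CAL3 S m e \<longleftrightarrow> commutative_loop S m e \<and> automorphic_loop S m e \<and> nilpotency_class_le S m e 3"

definition subloop :: "'a set \<Rightarrow> ('a \<Rightarrow> 'a \<Rightarrow> 'a) \<Rightarrow> 'a \<Rightarrow> 'a set \<Rightarrow> bool" where
  "subloop S m e T \<longleftrightarrow> T \<subseteq> S \<and> e \<in> T \<and> (\<forall>a\<in>T. \<forall>b\<in>T. m a b \<in> T) \<and>
     (\<forall>a\<in>T. \<forall>b\<in>T. \<forall>c\<in>S. (m a c = b \<or> m c a = b) \<longrightarrow> c \<in> T)"

definition loop_hom ::
  "'a set \<Rightarrow> ('a \<Rightarrow> 'a \<Rightarrow> 'a) \<Rightarrow> 'b set \<Rightarrow> ('b \<Rightarrow> 'b \<Rightarrow> 'b) \<Rightarrow> ('a \<Rightarrow> 'b) \<Rightarrow> bool" where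
  "loop_hom S m T n h \<longleftrightarrow> h ` S \<subseteq> T \<and> (\<forall>a\<in>S. \<forall>b\<in>S. h (m a b) = n (h a) (h b))"

text \<open>(S,m,e) is the free object on x, y in the variety CAL3: it lies in the
  variety, is generated by x and y, and every assignment of x, y into a member
  of the variety extends to a homomorphism. Targets are taken with carriers in
  the countably infinite type int list; since the free object is generated by
  two elements (hence countable) this loses no generality.\<close>

definition free_CAL3 :: "'a set \<Rightarrow> ('a \<Rightarrow> 'a \<Rightarrow> 'a) \<Rightarrow> 'a \<Rightarrow> 'a \<Rightarrow> 'a \<Rightarrow> bool" where
  "free_CAL3 S m e x y \<longleftrightarrow> CAL3 S m e \<and> x \<in> S \<and> y \<in> S \<and>
     (\<forall>T. subloop S m e T \<and> x \<in> T \<and> y \<in> T \<longrightarrow> S \<subseteq> T) \<and>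
     (\<forall>(T :: int list set) n u a b. CAL3 T n u \<and> a \<in> T \<and> b \<in> T \<longrightarrow>
        (\<exists>h. loop_hom S m T n h \<and> h x = a \<and> h y = b))"

primrec npow :: "('a \<Rightarrow> 'a \<Rightarrow> 'a) \<Rightarrow> 'a \<Rightarrow> 'a \<Rightarrow> nat \<Rightarrow> 'a" where
  "npow m e a 0 = e"
| "npow m e a (Suc k) = m a (npow m e a k)"

definition linv :: "'a set \<Rightarrow> ('a \<Rightarrow> 'a \<Rightarrow> 'a) \<Rightarrow> 'a \<Rightarrow> 'a \<Rightarrow> 'a" where
  "linv S m e a = (THE b. b \<in> S \<and> m a b = e)"

definition ipow :: "'a set \<Rightarrow> ('a \<Rightarrow> 'a \<Rightarrow> 'a) \<Rightarrow> 'a \<Rightarrow> 'a \<Rightarrow> int \<Rightarrow> 'a" where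
  "ipow S m e a k = (if 0 \<le> k then npow m e a (nat k) else linv S m e (npow m e a (nat (- k))))"

definition associator :: "'a set \<Rightarrow> ('a \<Rightarrow> 'a \<Rightarrow> 'a) \<Rightarrow> 'a \<Rightarrow> 'a \<Rightarrow> 'a \<Rightarrow> 'a" where
  "associator S m a b c = (THE z. z \<in> S \<and> m (m a b) c = m (m a (m b c)) z)"

definition alpha :: "int \<Rightarrow> int" where "alpha k = (k ^ 3 - k) div 3"
definition beta :: "int \<Rightarrow> int" where "beta k = k ^ 2 - k"

definition Z8 :: "int list set" where "Z8 = {a. length a = 8}"

definition star :: "int list \<Rightarrow> int list \<Rightarrow> int list" where
  "star a b = (let
     a1 = a!0; a2 = a!1; a3 = a!2; a4 = a!3; a5 = a!4; a6 = a!5; a7 = a!6; a8 = a!7;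
     b1 = b!0; b2 = b!1; b3 = b!2; b4 = b!3; b5 = b!4; b6 = b!5; b7 = b!6; b8 = b!7 in
   [a1 + b1,
    a2 + b2,
    a3 + b3 - a1*b1*(a2 + b2),
    a4 + b4 + a2*b2*(a1 + b1),
    a5 + b5 + (a2 + b2)*(b1*alpha a1 + a1*alpha b1) + a2*(a1*beta b1 + b1^2*beta a1)
      + b2*(b1*beta a1 + a1^2*beta b1) - a1*b1*(a3 + b3),
    a6 + b6 + 2*a1*a2*b1*b2*(a1 + b1) + (a2 + b2)*(a1*beta b1 + b1*beta a1)
      + (beta a2 + beta b2)*(a1*b1^2 + b1*a1^2)
      - a2*b2*alpha (a1 + b1) - a1*b1*(a4 + b4) - (a3 + b3)*(a1*b2 + a2*b1),
    a7 + b7 - 2*a1*a2*b1*b2*(a2 + b2) - (a1 + b1)*(a2*beta b2 + b2*beta a2)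
      - (beta a1 + beta b1)*(a2*b2^2 + b2*a2^2)
      + a1*b1*alpha (a2 + b2) - a2*b2*(a3 + b3) - (a4 + b4)*(a1*b2 + a2*b1),
    a8 + b8 - (a1 + b1)*(a2*alpha b2 + b2*alpha a2) - a1*(a2*beta b2 + b2^2*beta a2)
      - b1*(b2*beta a2 + a2^2*beta b2) - a2*b2*(a4 + b4)])"

end

theory Submission
  imports Defs
begin

text \<open>The product on eight-tuples of integers is checked to be a commutative automorphic loop of class three
  by exhibiting its inner mappings as explicit automorphisms. Freeness then gives a homomorphism from the
  free loop to it which maps the normal form with exponents \<open>a\<close> to \<open>a\<close>, so it remains to show that every
  element has a normal form. For \<open>z\<close> in the second centre the associator \<open>(z, a, b)\<close> is central and additive
  in each argument, and it vanishes when \<open>a\<close> or \<open>b\<close> is itself an associator. Applying inner mappings to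
  the identities defining \<open>u1\<close> and \<open>u2\<close> yields \<open>(u1, x, y) = (u1, y, x) = (u2, x, x)\<close> and, by symmetry, the
  corresponding relations for \<open>u2\<close>. Hence \<open>u1\<close> and \<open>u2\<close> are central modulo the group generated by the \<open>v\<close>s.
  Modulo \<open>u1\<close> and \<open>u2\<close> the loop is associative, because fixed points of inner automorphisms form subloops.
  Adding the powers of \<open>v4\<close>, \<open>v3\<close>, \<open>v2\<close>, \<open>v1\<close>, \<open>u2\<close>, \<open>u1\<close>, \<open>y\<close>, \<open>x\<close> one at a time to the kernel of a congruence
  ends with everything, and unwinding this chain produces the exponents.\<close>

section \<open>Commutative loops and their inner mappings\<close>

locale comm_loop =
  fixes S :: "'a set" and m :: "'a \<Rightarrow> 'a \<Rightarrow> 'a" (infixl "\<cdot>" 70) and e :: 'a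
  assumes commutative_loop: "commutative_loop S m e"
begin

lemma loop: "loop S m e"
  using commutative_loop by (simp add: commutative_loop_def)

lemma unit_in [simp, intro]: "e \<in> S"
  using loop by (simp add: loop_def)

lemma left_unit [simp]: "a \<in> S \<Longrightarrow> e \<cdot> a = a" and right_unit [simp]: "a \<in> S \<Longrightarrow> a \<cdot> e = a"
  using loop by (auto simp: loop_def)

lemma bij_translation: "a \<in> S \<Longrightarrow> bij_betw (m a) S S"
  using loop by (auto simp: loop_def)

lemma closed [simp, intro]: "a \<in> S \<Longrightarrow> b \<in> S \<Longrightarrow> a \<cdot> b \<in> S"
  using bij_translation by (auto simp: bij_betw_def)

lemma comm: "a \<in> S \<Longrightarrow> b \<in> S \<Longrightarrow> a \<cdot> b = b \<cdot> a"
  using commutative_loop by (auto simp: commutative_loop_def)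

lemma left_cancel [simp]: "a \<in> S \<Longrightarrow> b \<in> S \<Longrightarrow> c \<in> S \<Longrightarrow> a \<cdot> b = a \<cdot> c \<longleftrightarrow> b = c"
  using bij_translation[of a] by (auto simp: bij_betw_def inj_on_def)

lemma right_cancel [simp]: "a \<in> S \<Longrightarrow> b \<in> S \<Longrightarrow> c \<in> S \<Longrightarrow> b \<cdot> a = c \<cdot> a \<longleftrightarrow> b = c"
  using left_cancel comm by metis

lemma divide: "a \<in> S \<Longrightarrow> b \<in> S \<Longrightarrow> \<exists>c\<in>S. a \<cdot> c = b"
  using bij_translation[of a] unfolding bij_betw_def by (metis imageE)

lemma mlt_bij: "f \<in> mlt S m \<Longrightarrow> bij_betw f S S"
proof (induction rule: mlt.induct)
  case mlt_id
  then show ?case by (auto simp: bij_betw_def inj_on_def)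
next
  case (mlt_L a)
  then show ?case using bij_translation by (simp cong: bij_betw_cong)
next
  case (mlt_R a)
  then have "bij_betw (restrict (\<lambda>z. z \<cdot> a) S) S S \<longleftrightarrow> bij_betw (m a) S S"
    by (intro bij_betw_cong) (auto simp: comm)
  then show ?case using bij_translation mlt_R by blast
next
  case (mlt_comp f g)
  have "bij_betw (restrict (\<lambda>z. g (f z)) S) S S \<longleftrightarrow> bij_betw (g \<circ> f) S S"
    by (intro bij_betw_cong) auto
  then show ?case using mlt_comp bij_betw_trans by blast
next
  case (mlt_inv f)
  have "bij_betw (restrict (inv_into S f) S) S S \<longleftrightarrow> bij_betw (inv_into S f) S S"
    by (intro bij_betw_cong) auto
  then show ?case using mlt_inv bij_betw_inv_into by blast
qed

text \<open>The map is the generator L_{a,b} of the inner mapping group. It is exposed only through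
  an equation free of division, the form that later calculations can use.\<close>

lemma inner_lam:
  assumes "a \<in> S" "b \<in> S"
  obtains f where "f \<in> inn S m e" "\<And>c. c \<in> S \<Longrightarrow> f c \<in> S" "\<And>c. c \<in> S \<Longrightarrow> (b \<cdot> a) \<cdot> f c = b \<cdot> (a \<cdot> c)"
proof
  let ?L = "\<lambda>a. restrict (m a) S"
  let ?g = "restrict (inv_into S (?L (b \<cdot> a))) S"
  let ?f = "restrict (\<lambda>z. ?g (restrict (\<lambda>z. ?L b (?L a z)) S z)) S"
  have f: "?f \<in> mlt S m"
    using assms by (intro mlt.intros) auto
  have bij: "bij_betw (?L (b \<cdot> a)) S S"
    using assms by (intro mlt_bij mlt.intros) auto
  have *: "?f c \<in> S \<and> (b \<cdot> a) \<cdot> ?f c = b \<cdot> (a \<cdot> c)" if "c \<in> S" for c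
  proof -
    have c: "b \<cdot> (a \<cdot> c) \<in> S" using assms that by blast
    have "inv_into S (?L (b \<cdot> a)) (b \<cdot> (a \<cdot> c)) \<in> S"
      using bij c by (metis bij_betw_imp_surj_on inv_into_into)
    moreover have "?L (b \<cdot> a) (inv_into S (?L (b \<cdot> a)) (b \<cdot> (a \<cdot> c))) = b \<cdot> (a \<cdot> c)"
      using bij c by (meson bij_betw_inv_into_right)
    ultimately show ?thesis
      using assms that by simp
  qed
  then show "?f c \<in> S" "(b \<cdot> a) \<cdot> ?f c = b \<cdot> (a \<cdot> c)" if "c \<in> S" for c
    using that by blast+
  have "(b \<cdot> a) \<cdot> ?f e = (b \<cdot> a) \<cdot> e" "?f e \<in> S"
    using *[of e] assms by auto
  then have "?f e = e"
    using assms left_cancel[of "b \<cdot> a" "?f e" e] by blast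
  then show "?f \<in> inn S m e"
    unfolding inn_def using f by blast
qed

text \<open>Multiplicativity of all L_{a,b} in elementwise form: \<open>c'\<close> and
  \<open>d'\<close> stand for the images of \<open>c\<close> and \<open>d\<close>, so neither
  inverses nor the multiplication group occur. For commutative loops this turns out to be equivalent
  to being automorphic.\<close>

definition lam_hom :: bool where
  "lam_hom \<longleftrightarrow> (\<forall>a\<in>S. \<forall>b\<in>S. \<forall>c\<in>S. \<forall>d\<in>S. \<forall>c'\<in>S. \<forall>d'\<in>S.
     (b \<cdot> a) \<cdot> c' = b \<cdot> (a \<cdot> c) \<longrightarrow> (b \<cdot> a) \<cdot> d' = b \<cdot> (a \<cdot> d) \<longrightarrow>
     (b \<cdot> a) \<cdot> (c' \<cdot> d') = b \<cdot> (a \<cdot> (c \<cdot> d)))"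

lemma lam_homD:
  assumes "lam_hom" "(b \<cdot> a) \<cdot> c' = b \<cdot> (a \<cdot> c)" "(b \<cdot> a) \<cdot> d' = b \<cdot> (a \<cdot> d)"
    "a \<in> S" "b \<in> S" "c \<in> S" "d \<in> S" "c' \<in> S" "d' \<in> S"
  shows "(b \<cdot> a) \<cdot> (c' \<cdot> d') = b \<cdot> (a \<cdot> (c \<cdot> d))"
  using assms unfolding lam_hom_def by blast

lemma automorphic_imp_lam_hom:
  assumes "automorphic_loop S m e"
  shows lam_hom
  unfolding lam_hom_def
proof (intro ballI impI)
  fix a b c d c' d'
  assume S: "a \<in> S" "b \<in> S" "c \<in> S" "d \<in> S" "c' \<in> S" "d' \<in> S"
    and eq: "(b \<cdot> a) \<cdot> c' = b \<cdot> (a \<cdot> c)" "(b \<cdot> a) \<cdot> d' = b \<cdot> (a \<cdot> d)"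
  obtain f where f: "f \<in> inn S m e" "\<And>c. c \<in> S \<Longrightarrow> f c \<in> S" "\<And>c. c \<in> S \<Longrightarrow> (b \<cdot> a) \<cdot> f c = b \<cdot> (a \<cdot> c)"
    using inner_lam[OF S(1,2)] by blast
  have "c' = f c" "d' = f d"
    using f S eq left_cancel[of "b \<cdot> a"] by (metis closed)+
  moreover have "f (c \<cdot> d) = f c \<cdot> f d"
    using assms f(1) S unfolding automorphic_loop_def automorphism_def by blast
  ultimately show "(b \<cdot> a) \<cdot> (c' \<cdot> d') = b \<cdot> (a \<cdot> (c \<cdot> d))"
    using f(3) S by (metis closed)
qed

lemma lam_automorphism:
  assumes "lam_hom" "a \<in> S" "b \<in> S"
  obtains f where "automorphism S m f" "\<And>c. c \<in> S \<Longrightarrow> (b \<cdot> a) \<cdot> f c = b \<cdot> (a \<cdot> c)"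
proof -
  obtain f where f: "f \<in> inn S m e" "\<And>c. c \<in> S \<Longrightarrow> f c \<in> S" "\<And>c. c \<in> S \<Longrightarrow> (b \<cdot> a) \<cdot> f c = b \<cdot> (a \<cdot> c)"
    using inner_lam[OF assms(2,3)] by blast
  have "f (c \<cdot> d) = f c \<cdot> f d" if "c \<in> S" "d \<in> S" for c d
  proof -
    have "(b \<cdot> a) \<cdot> (f c \<cdot> f d) = (b \<cdot> a) \<cdot> f (c \<cdot> d)"
      using lam_homD[OF assms(1) f(3)[OF that(1)] f(3)[OF that(2)]] f assms that by simp
    then show ?thesis
      using left_cancel[of "b \<cdot> a" "f c \<cdot> f d" "f (c \<cdot> d)"] f assms that by simp
  qed
  then have "automorphism S m f"
    using mlt_bij f(1) by (auto simp: automorphism_def inn_def)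
  then show thesis using that f(3) by blast
qed

section \<open>Automorphisms and the multiplication group\<close>

lemma automorphismD:
  assumes "automorphism S m f"
  shows "bij_betw f S S" "a \<in> S \<Longrightarrow> f a \<in> S" "a \<in> S \<Longrightarrow> b \<in> S \<Longrightarrow> f (a \<cdot> b) = f a \<cdot> f b"
    and automorphism_unit: "f e = e"
proof -
  show b: "bij_betw f S S" and c: "\<And>a. a \<in> S \<Longrightarrow> f a \<in> S"
    and d: "\<And>a b. a \<in> S \<Longrightarrow> b \<in> S \<Longrightarrow> f (a \<cdot> b) = f a \<cdot> f b"
    using assms by (auto simp: automorphism_def bij_betw_def)
  have "f e \<cdot> f e = f e \<cdot> e"
    using c d[of e e] by simp
  then show "f e = e" using c left_cancel[of "f e" "f e" e] by blast
qed

lemma automorphism_comp: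
  assumes "automorphism S m f" "automorphism S m g"
  shows "automorphism S m (\<lambda>z. g (f z))"
proof -
  have "bij_betw (g \<circ> f) S S"
    using assms automorphismD(1) bij_betw_trans by blast
  then show ?thesis
    using assms automorphismD(2,3) by (auto simp: automorphism_def comp_def)
qed

lemma automorphism_inv:
  assumes "automorphism S m f"
  shows "automorphism S m (inv_into S f)"
  unfolding automorphism_def
proof (intro conjI ballI)
  show bij: "bij_betw (inv_into S f) S S"
    using assms automorphismD(1) bij_betw_inv_into by blast
  fix a b assume S: "a \<in> S" "b \<in> S"
  have inS: "inv_into S f a \<in> S" "inv_into S f b \<in> S"
    using bij S by (auto simp: bij_betw_def)
  then have "f (inv_into S f a \<cdot> inv_into S f b) = a \<cdot> b"
    using S bij_betw_inv_into_right[OF automorphismD(1)[OF assms]]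
    by (simp add: automorphismD(3)[OF assms])
  then show "inv_into S f (a \<cdot> b) = inv_into S f a \<cdot> inv_into S f b"
    using automorphismD(1)[OF assms] inS by (metis bij_betw_inv_into_left closed)
qed

text \<open>Automorphisms followed by a translation are closed under composition and inversion: two
  successive translations amount to some L_{a,b} followed by one translation, and L_{a,b} is an
  automorphism by \<open>lam_hom\<close>.\<close>

lemma mlt_decomp:
  assumes lam_hom "f \<in> mlt S m"
  shows "\<exists>g. automorphism S m g \<and> (\<exists>c\<in>S. \<forall>z\<in>S. f z = c \<cdot> g z)"
  using assms(2)
proof (induction rule: mlt.induct)
  case mlt_id
  have "automorphism S m (\<lambda>z. z)" by (simp add: automorphism_def bij_betw_def)
  then show ?case by (intro exI[of _ "\<lambda>z. z"] conjI bexI[of _ e]) auto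
next
  case (mlt_L a)
  have "automorphism S m (\<lambda>z. z)" by (simp add: automorphism_def bij_betw_def)
  then show ?case using mlt_L by (intro exI[of _ "\<lambda>z. z"] conjI bexI[of _ a]) auto
next
  case (mlt_R a)
  have "automorphism S m (\<lambda>z. z)" by (simp add: automorphism_def bij_betw_def)
  then show ?case using mlt_R by (intro exI[of _ "\<lambda>z. z"] conjI bexI[of _ a]) (simp_all add: comm[of _ a])
next
  case (mlt_comp f f')
  then obtain g c g' c' where g: "automorphism S m g" "c \<in> S" "\<forall>z\<in>S. f z = c \<cdot> g z"
      "automorphism S m g'" "c' \<in> S" "\<forall>z\<in>S. f' z = c' \<cdot> g' z" by blast
  have g'c: "g' c \<in> S" using automorphismD(2)[OF g(4,2)] .
  obtain h where h: "automorphism S m h" "\<And>z. z \<in> S \<Longrightarrow> (c' \<cdot> g' c) \<cdot> h z = c' \<cdot> (g' c \<cdot> z)"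
    using lam_automorphism[OF assms(1) g'c g(5)] by blast
  have "f' (f z) = (c' \<cdot> g' c) \<cdot> h (g' (g z))" if z: "z \<in> S" for z
  proof -
    have "g z \<in> S" "g' (g z) \<in> S" using automorphismD(2)[OF g(1) z] automorphismD(2)[OF g(4)] by blast+
    then show ?thesis using g h z automorphismD(3)[OF g(4)] by simp
  qed
  moreover have "automorphism S m (\<lambda>z. h (g' (g z)))"
    using automorphism_comp[OF automorphism_comp[OF g(1,4)] h(1)] .
  ultimately show ?case using g g'c by (intro exI conjI bexI[of _ "c' \<cdot> g' c"]) auto
next
  case (mlt_inv f)
  then obtain g c where g: "automorphism S m g" "c \<in> S" "\<forall>z\<in>S. f z = c \<cdot> g z" by blast
  obtain c' where c': "c' \<in> S" "c \<cdot> c' = e" using divide[OF g(2), of e] by blast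
  obtain h where h: "automorphism S m h" "\<And>z. z \<in> S \<Longrightarrow> (c \<cdot> c') \<cdot> h z = c \<cdot> (c' \<cdot> z)"
    using lam_automorphism[OF assms(1) c'(1) g(2)] by blast
  \<comment> \<open>Since \<open>c \<cdot> c' = e\<close>, the map \<open>h\<close> sends
    \<open>z\<close> to \<open>c \<cdot> (c' \<cdot> z)\<close>, so \<open>c \<cdot> w = z\<close>
    is solved by \<open>c'\<close> times the preimage of \<open>z\<close> under \<open>h\<close>.
    Pulling this product back through \<open>g\<close> gives \<open>d \<cdot> k z\<close>.\<close>
  define k where "k = (\<lambda>z. inv_into S g (inv_into S h z))"
  have k: "automorphism S m k"
    unfolding k_def using automorphism_comp[OF automorphism_inv[OF h(1)] automorphism_inv[OF g(1)]] .
  define d where "d = inv_into S g c'"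
  have d: "d \<in> S" "g d = c'"
    using automorphismD(1)[OF g(1)] c' unfolding d_def
    by (auto simp: bij_betw_inv_into_right bij_betw_def inv_into_into)
  have "inv_into S f z = d \<cdot> k z" if z: "z \<in> S" for z
  proof -
    have iz: "inv_into S h z \<in> S" "h (inv_into S h z) = z"
      using automorphismD(1)[OF h(1)] z
      by (auto simp: bij_betw_inv_into_right bij_betw_def inv_into_into)
    have kz: "k z \<in> S" "g (k z) = inv_into S h z"
      using automorphismD(1)[OF g(1)] iz unfolding k_def
      by (auto simp: bij_betw_inv_into_right bij_betw_def inv_into_into)
    have "f (d \<cdot> k z) = c \<cdot> (c' \<cdot> inv_into S h z)"
      using g d kz automorphismD(3)[OF g(1)] by simp
    also have "\<dots> = (c \<cdot> c') \<cdot> h (inv_into S h z)"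
      using h(2)[OF iz(1)] by simp
    also have "\<dots> = z" using c' iz z by simp
    finally show ?thesis
      using mlt_bij[OF mlt_inv.hyps] d kz by (metis bij_betw_inv_into_left closed)
  qed
  then show ?case using k d by (intro exI[of _ k] conjI bexI[of _ d]) auto
qed

text \<open>By \<open>mlt_decomp\<close> an inner mapping is an automorphism followed by a
  translation; evaluation at \<open>e\<close> shows that the translation is by
  \<open>e\<close>.\<close>

lemma lam_hom_imp_automorphic:
  assumes lam_hom
  shows "automorphic_loop S m e"
  unfolding automorphic_loop_def
proof (intro conjI ballI)
  show "loop S m e" by (rule loop)
  fix f assume f: "f \<in> inn S m e"
  then obtain g c where g: "automorphism S m g" "c \<in> S" "\<forall>z\<in>S. f z = c \<cdot> g z"
    using mlt_decomp[OF assms] unfolding inn_def by blast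
  have "f e = c" using g automorphism_unit[OF g(1)] by simp
  then have "c = e" using f by (simp add: inn_def)
  then have fg: "f z = g z" if "z \<in> S" for z
    using g that automorphismD(2)[OF g(1)] by simp
  then have "bij_betw f S S \<longleftrightarrow> bij_betw g S S" by (intro bij_betw_cong)
  then show "automorphism S m f"
    using g(1) fg unfolding automorphism_def by simp
qed

text \<open>An element fixed by every L_{b,c} associates with all pairs, by commutativity.
  Conversely, translation by such an element commutes with the whole multiplication group, so
  \<open>f a = f (a \<cdot> e) = a \<cdot> f e = a\<close> for inner \<open>f\<close>.\<close>

lemma center_eq: "center S m e = {a \<in> S. \<forall>b\<in>S. \<forall>c\<in>S. (a \<cdot> b) \<cdot> c = a \<cdot> (b \<cdot> c)}"
proof (intro equalityI subsetI)
  fix a assume a: "a \<in> center S m e"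
  then have aS: "a \<in> S" by (simp add: center_def)
  have "(a \<cdot> b) \<cdot> c = a \<cdot> (b \<cdot> c)" if bc: "b \<in> S" "c \<in> S" for b c
  proof -
    obtain f where "f \<in> inn S m e" "(c \<cdot> b) \<cdot> f a = c \<cdot> (b \<cdot> a)"
      using inner_lam[OF bc] aS by metis
    then have "(c \<cdot> b) \<cdot> a = c \<cdot> (b \<cdot> a)" using a unfolding center_def by fastforce
    then show ?thesis using aS bc comm by (metis closed)
  qed
  then show "a \<in> {a \<in> S. \<forall>b\<in>S. \<forall>c\<in>S. (a \<cdot> b) \<cdot> c = a \<cdot> (b \<cdot> c)}" using aS by blast
next
  fix a assume "a \<in> {a \<in> S. \<forall>b\<in>S. \<forall>c\<in>S. (a \<cdot> b) \<cdot> c = a \<cdot> (b \<cdot> c)}"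
  then have aS: "a \<in> S" and a: "\<And>b c. b \<in> S \<Longrightarrow> c \<in> S \<Longrightarrow> (a \<cdot> b) \<cdot> c = a \<cdot> (b \<cdot> c)" by auto
  have *: "\<forall>z\<in>S. f (a \<cdot> z) = a \<cdot> f z" if "f \<in> mlt S m" for f
    using that
  proof (induction rule: mlt.induct)
    case mlt_id
    then show ?case using aS by simp
  next
    case (mlt_L b)
    then have "\<And>z. z \<in> S \<Longrightarrow> b \<cdot> (a \<cdot> z) = a \<cdot> (b \<cdot> z)"
      using aS a by (metis closed comm)
    then show ?case using aS by simp
  next
    case (mlt_R b)
    then show ?case using aS a by simp
  next
    case (mlt_comp f g)
    then show ?case using aS mlt_bij[OF mlt_comp.hyps(1)] by (auto simp: bij_betw_def)
  next
    case (mlt_inv f)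
    have bij: "bij_betw f S S" using mlt_bij mlt_inv by blast
    show ?case
    proof
      fix z assume z: "z \<in> S"
      have i: "inv_into S f z \<in> S" "f (inv_into S f z) = z"
        using bij z by (auto simp: bij_betw_inv_into_right bij_betw_def inv_into_into)
      then have "f (a \<cdot> inv_into S f z) = a \<cdot> z" using mlt_inv by simp
      then show "restrict (inv_into S f) S (a \<cdot> z) = a \<cdot> restrict (inv_into S f) S z"
        using bij i aS z by (metis bij_betw_inv_into_left closed restrict_apply')
    qed
  qed
  have "f a = a" if f: "f \<in> inn S m e" for f
  proof -
    have "f (a \<cdot> e) = a \<cdot> f e" using * f unfolding inn_def by blast
    then show ?thesis using f aS by (simp add: inn_def)
  qed
  then show "a \<in> center S m e" using aS by (simp add: center_def)
qed

end

section \<open>Congruences and the upper central series\<close>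

text \<open>Successive quotients are modelled as relations on the single carrier \<open>S\<close>,
  which avoids cosets of cosets. Cancellation is an axiom of its own because in an infinite loop a
  multiplicative equivalence relation can have a quotient that is not a loop.\<close>

locale loop_congruence = comm_loop +
  fixes R :: "'a \<Rightarrow> 'a \<Rightarrow> bool" (infix "\<approx>" 50)
  assumes R_in: "a \<approx> b \<Longrightarrow> a \<in> S \<and> b \<in> S"
    and R_refl [simp, intro]: "a \<in> S \<Longrightarrow> a \<approx> a"
    and R_sym: "a \<approx> b \<Longrightarrow> b \<approx> a"
    and R_trans [trans]: "a \<approx> b \<Longrightarrow> b \<approx> c \<Longrightarrow> a \<approx> c"
    and R_mult: "a \<approx> b \<Longrightarrow> c \<approx> d \<Longrightarrow> a \<cdot> c \<approx> b \<cdot> d"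
    and R_cancel: "a \<in> S \<Longrightarrow> b \<in> S \<Longrightarrow> c \<in> S \<Longrightarrow> a \<cdot> b \<approx> a \<cdot> c \<Longrightarrow> b \<approx> c"
begin

lemma R_left: "a \<in> S \<Longrightarrow> b \<approx> c \<Longrightarrow> a \<cdot> b \<approx> a \<cdot> c" and R_right: "a \<in> S \<Longrightarrow> b \<approx> c \<Longrightarrow> b \<cdot> a \<approx> c \<cdot> a"
  using R_mult by blast+

lemma R_cancel_mult:
  assumes "a \<in> S" "b \<in> S" "a' \<in> S" "b' \<in> S" "a \<cdot> b \<approx> a' \<cdot> b'" "a \<approx> a'"
  shows "b \<approx> b'"
proof -
  have "a' \<cdot> b \<approx> a' \<cdot> b'"
    using R_trans[OF R_right[OF assms(2) R_sym[OF assms(6)]] assms(5)] .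
  then show ?thesis using R_cancel assms by blast
qed

text \<open>The preimage of the center of the quotient: by \<open>center_eq\<close>, associating in
  the first place suffices in a commutative loop.\<close>

definition nucleus :: "'a set" where
  "nucleus = {a \<in> S. \<forall>b\<in>S. \<forall>c\<in>S. (a \<cdot> b) \<cdot> c \<approx> a \<cdot> (b \<cdot> c)}"

lemma nucleus_in: "k \<in> nucleus \<Longrightarrow> k \<in> S"
  by (simp add: nucleus_def)

lemma nucleusD: "k \<in> nucleus \<Longrightarrow> b \<in> S \<Longrightarrow> c \<in> S \<Longrightarrow> (k \<cdot> b) \<cdot> c \<approx> k \<cdot> (b \<cdot> c)"
  by (simp add: nucleus_def)

lemma nucleus_right: "k \<in> nucleus \<Longrightarrow> b \<in> S \<Longrightarrow> c \<in> S \<Longrightarrow> b \<cdot> (c \<cdot> k) \<approx> (b \<cdot> c) \<cdot> k"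
  using nucleusD[of k c b] nucleus_in[of k] comm[of b "c \<cdot> k"] comm[of c k] comm[of k "b \<cdot> c"] comm[of b c]
  by auto

lemma nucleus_mid: "k \<in> nucleus \<Longrightarrow> b \<in> S \<Longrightarrow> c \<in> S \<Longrightarrow> (b \<cdot> k) \<cdot> c \<approx> b \<cdot> (k \<cdot> c)"
proof -
  assume k: "k \<in> nucleus" and S: "b \<in> S" "c \<in> S"
  have kS: "k \<in> S" using k nucleus_in by blast
  have "(b \<cdot> k) \<cdot> c \<approx> k \<cdot> (b \<cdot> c)" using nucleusD[OF k S] S kS comm by metis
  also have "k \<cdot> (b \<cdot> c) \<approx> (k \<cdot> c) \<cdot> b" using R_sym[OF nucleusD[OF k S(2,1)]] S comm by metis
  also have "(k \<cdot> c) \<cdot> b = b \<cdot> (k \<cdot> c)" using S kS comm by blast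
  finally show ?thesis .
qed

lemma nucleus_saturated:
  assumes "k \<in> nucleus" "k \<approx> l"
  shows "l \<in> nucleus"
proof -
  have S: "k \<in> S" "l \<in> S" using assms R_in by blast+
  have "(l \<cdot> b) \<cdot> c \<approx> l \<cdot> (b \<cdot> c)" if bc: "b \<in> S" "c \<in> S" for b c
  proof -
    have "(l \<cdot> b) \<cdot> c \<approx> (k \<cdot> b) \<cdot> c" using R_right R_sym[OF assms(2)] bc by blast
    also have "\<dots> \<approx> k \<cdot> (b \<cdot> c)" using nucleusD assms bc by blast
    also have "\<dots> \<approx> l \<cdot> (b \<cdot> c)" using R_right assms(2) bc by blast
    finally show ?thesis .
  qed
  then show ?thesis using S by (simp add: nucleus_def)
qed

lemma unit_nucleus: "e \<in> nucleus"
  by (auto simp: nucleus_def)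

lemma nucleus_mult:
  assumes k: "k \<in> nucleus" and l: "l \<in> nucleus"
  shows "k \<cdot> l \<in> nucleus"
proof -
  have S: "k \<in> S" "l \<in> S" using assms nucleus_in by blast+
  have "((k \<cdot> l) \<cdot> b) \<cdot> c \<approx> (k \<cdot> l) \<cdot> (b \<cdot> c)" if bc: "b \<in> S" "c \<in> S" for b c
  proof -
    have "((k \<cdot> l) \<cdot> b) \<cdot> c \<approx> (k \<cdot> (l \<cdot> b)) \<cdot> c"
      using nucleusD[OF k S(2) bc(1)] R_right bc by blast
    also have "\<dots> \<approx> k \<cdot> ((l \<cdot> b) \<cdot> c)" using nucleusD[OF k] S bc by blast
    also have "\<dots> \<approx> k \<cdot> (l \<cdot> (b \<cdot> c))" by (intro R_left nucleusD[OF l] S bc)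
    also have "\<dots> \<approx> (k \<cdot> l) \<cdot> (b \<cdot> c)" using R_sym[OF nucleusD[OF k]] S bc by blast
    finally show ?thesis .
  qed
  then show ?thesis using S by (simp add: nucleus_def)
qed

lemma nucleus_inverse:
  assumes k: "k \<in> nucleus" and l: "l \<in> S" "k \<cdot> l \<approx> e"
  shows "l \<in> nucleus"
proof -
  have S: "k \<in> S" using assms nucleus_in by blast
  have "(l \<cdot> b) \<cdot> c \<approx> l \<cdot> (b \<cdot> c)" if bc: "b \<in> S" "c \<in> S" for b c
  proof -
    have "k \<cdot> ((l \<cdot> b) \<cdot> c) \<approx> (k \<cdot> (l \<cdot> b)) \<cdot> c" using R_sym[OF nucleusD[OF k]] l bc by blast
    also have "\<dots> \<approx> ((k \<cdot> l) \<cdot> b) \<cdot> c" using R_sym[OF nucleusD[OF k]] R_right l bc by blast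
    also have "\<dots> \<approx> (e \<cdot> b) \<cdot> c" using l R_right bc by blast
    also have "(e \<cdot> b) \<cdot> c = e \<cdot> (b \<cdot> c)" using bc by simp
    also have "e \<cdot> (b \<cdot> c) \<approx> (k \<cdot> l) \<cdot> (b \<cdot> c)" using R_sym[OF l(2)] R_right bc by blast
    also have "\<dots> \<approx> k \<cdot> (l \<cdot> (b \<cdot> c))" using nucleusD[OF k] l bc by blast
    finally show ?thesis by (rule R_cancel[OF S, rotated -1]) (use l bc in auto)
  qed
  then show ?thesis using l by (simp add: nucleus_def)
qed

section \<open>Enlarging a congruence by central elements\<close>

definition central_subgroup :: "'a set \<Rightarrow> bool" where
  "central_subgroup K \<longleftrightarrow> K \<subseteq> nucleus \<and> e \<in> K \<and> (\<forall>k\<in>K. \<forall>l\<in>K. k \<cdot> l \<in> K) \<and> (\<forall>k\<in>K. \<exists>l\<in>K. k \<cdot> l \<approx> e)"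

definition extend :: "'a set \<Rightarrow> 'a \<Rightarrow> 'a \<Rightarrow> bool" where
  "extend K a b \<longleftrightarrow> a \<in> S \<and> b \<in> S \<and> (\<exists>k\<in>K. b \<approx> a \<cdot> k)"

lemma extendI: "a \<in> S \<Longrightarrow> k \<in> K \<Longrightarrow> b \<approx> a \<cdot> k \<Longrightarrow> extend K a b"
  using R_in by (auto simp: extend_def)

text \<open>\<open>K\<close> is central in the quotient, hence normal there, so its cosets form a
  congruence; the nucleus laws collect the factors from \<open>K\<close> on the right.\<close>

lemma loop_congruence_extend:
  assumes K: "central_subgroup K"
  shows "loop_congruence S m e (extend K)"
proof
  have KN: "k \<in> nucleus" and KS: "k \<in> S" if "k \<in> K" for k
    using K that nucleus_in by (auto simp: central_subgroup_def)
  fix a b c d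
  show "extend K a b \<Longrightarrow> a \<in> S \<and> b \<in> S" by (simp add: extend_def)
  show "extend K a a" if "a \<in> S"
    using that K extendI[of a e K a] by (simp add: central_subgroup_def)
  show "extend K b a" if ab: "extend K a b"
  proof -
    obtain k where k: "a \<in> S" "b \<in> S" "k \<in> K" "b \<approx> a \<cdot> k" using ab by (auto simp: extend_def)
    obtain l where l: "l \<in> K" "k \<cdot> l \<approx> e" using K k by (auto simp: central_subgroup_def)
    have "b \<cdot> l \<approx> (a \<cdot> k) \<cdot> l" using R_right KS k l by blast
    also have "\<dots> \<approx> a \<cdot> (k \<cdot> l)" using nucleus_mid KN KS k l by blast
    also have "\<dots> \<approx> a \<cdot> e" using R_left k l by blast
    finally have "a \<approx> b \<cdot> l" using R_sym k by simp
    then show ?thesis using extendI k l by blast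
  qed
  show "extend K a c" if ab: "extend K a b" and bc: "extend K b c"
  proof -
    obtain k where k: "a \<in> S" "b \<in> S" "k \<in> K" "b \<approx> a \<cdot> k" using ab by (auto simp: extend_def)
    obtain l where l: "l \<in> K" "c \<approx> b \<cdot> l" using bc by (auto simp: extend_def)
    note l(2)
    also have "b \<cdot> l \<approx> (a \<cdot> k) \<cdot> l" using R_right KS k l by blast
    also have "\<dots> \<approx> a \<cdot> (k \<cdot> l)" using nucleus_mid KN KS k l by blast
    finally show ?thesis
      by (rule extendI[rotated -1]) (use k l K in \<open>auto simp: central_subgroup_def\<close>)
  qed
  show "extend K (a \<cdot> c) (b \<cdot> d)" if ab: "extend K a b" and cd: "extend K c d"
  proof -
    obtain k where k: "a \<in> S" "b \<in> S" "k \<in> K" "b \<approx> a \<cdot> k" using ab by (auto simp: extend_def)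
    obtain l where l: "c \<in> S" "d \<in> S" "l \<in> K" "d \<approx> c \<cdot> l" using cd by (auto simp: extend_def)
    have S: "k \<in> S" "l \<in> S" using KS k l by blast+
    have "b \<cdot> d \<approx> (a \<cdot> k) \<cdot> (c \<cdot> l)" using R_mult k l by blast
    also have "\<dots> \<approx> ((a \<cdot> k) \<cdot> c) \<cdot> l" using nucleus_right KN k l S by blast
    also have "\<dots> = (c \<cdot> (a \<cdot> k)) \<cdot> l" using k l S comm by simp
    also have "\<dots> \<approx> ((c \<cdot> a) \<cdot> k) \<cdot> l" by (intro R_right nucleus_right KN k l S)
    also have "\<dots> \<approx> (c \<cdot> a) \<cdot> (k \<cdot> l)" using nucleus_mid KN k l S by blast
    also have "\<dots> = (a \<cdot> c) \<cdot> (k \<cdot> l)" using k l S comm by simp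
    finally show ?thesis
      by (rule extendI[rotated -1]) (use k l K in \<open>auto simp: central_subgroup_def\<close>)
  qed
  show "extend K b c" if S: "a \<in> S" "b \<in> S" "c \<in> S" and abc: "extend K (a \<cdot> b) (a \<cdot> c)"
  proof -
    obtain k where k: "k \<in> K" "a \<cdot> c \<approx> (a \<cdot> b) \<cdot> k" using abc by (auto simp: extend_def)
    note k(2)
    also have "(a \<cdot> b) \<cdot> k \<approx> a \<cdot> (b \<cdot> k)" using R_sym[OF nucleus_right] KN k S by blast
    finally have "c \<approx> b \<cdot> k" using R_cancel S KS k by blast
    then show ?thesis using extendI k S by blast
  qed
qed

lemma central_subgroup_nucleus: "central_subgroup nucleus"
  unfolding central_subgroup_def
proof (intro conjI ballI)
  fix k assume k: "k \<in> nucleus"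
  obtain l where "l \<in> S" "k \<cdot> l = e" using divide nucleus_in[OF k] unit_in by blast
  then show "\<exists>l\<in>nucleus. k \<cdot> l \<approx> e" using nucleus_inverse[OF k] R_refl[OF unit_in] by metis
qed (auto intro: unit_nucleus nucleus_mult)

lemma extend_nucleus_unit: "{a. extend nucleus a e} = nucleus"
proof -
  interpret E: loop_congruence S m e "extend nucleus"
    using loop_congruence_extend central_subgroup_nucleus .
  have "extend nucleus e a \<longleftrightarrow> a \<in> nucleus" for a
  proof
    assume "extend nucleus e a"
    then obtain k where k: "k \<in> nucleus" "a \<approx> e \<cdot> k" by (auto simp: extend_def)
    then have "k \<approx> a" using nucleus_in R_sym by simp
    then show "a \<in> nucleus" using nucleus_saturated k by blast
  next
    assume "a \<in> nucleus"
    then show "extend nucleus e a" using extendI[of e a nucleus a] nucleus_in by simp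
  qed
  then show ?thesis using E.R_sym by blast
qed

section \<open>Cosets of the kernel and the upper central series\<close>

definition coset :: "'a \<Rightarrow> 'a set" where "coset a = {b. a \<approx> b}"

lemma lcoset_kernel:
  assumes "a \<in> S"
  shows "lcoset m a {a. a \<approx> e} = coset a"
proof (intro equalityI subsetI)
  fix b assume "b \<in> lcoset m a {a. a \<approx> e}"
  then obtain n where n: "n \<approx> e" "b = a \<cdot> n" by (auto simp: lcoset_def)
  then have "a \<cdot> e \<approx> b" using R_left[OF assms] R_sym by blast
  then show "b \<in> coset a" using assms by (simp add: coset_def)
next
  fix b assume "b \<in> coset a"
  then have b: "a \<approx> b" "b \<in> S" using R_in by (auto simp: coset_def)
  then obtain n where n: "n \<in> S" "a \<cdot> n = b" using divide assms by blast
  then have "n \<approx> e" using R_cancel[OF assms n(1) unit_in] R_sym b assms by simp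
  then show "b \<in> lcoset m a {a. a \<approx> e}" using n by (auto simp: lcoset_def)
qed

lemma coset_eq: "a \<in> S \<Longrightarrow> b \<in> S \<Longrightarrow> coset a = coset b \<longleftrightarrow> a \<approx> b"
  unfolding coset_def using R_sym R_trans by blast

lemma quot_carrier_kernel: "quot_carrier S m {a. a \<approx> e} = coset ` S"
  unfolding quot_carrier_def using lcoset_kernel by auto

lemma quot_mult_kernel:
  assumes "a \<in> S" "b \<in> S"
  shows "quot_mult m {a. a \<approx> e} (coset a) (coset b) = coset (a \<cdot> b)"
proof -
  let ?a = "SOME x. x \<in> coset a" and ?b = "SOME x. x \<in> coset b"
  have "?a \<in> coset a" "?b \<in> coset b"
    using assms someI[of "\<lambda>x. x \<in> coset a" a] someI[of "\<lambda>x. x \<in> coset b" b]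
    by (simp_all add: coset_def)
  then have "a \<approx> ?a" "b \<approx> ?b" by (simp_all add: coset_def)
  then have "a \<cdot> b \<approx> ?a \<cdot> ?b" "?a \<cdot> ?b \<in> S" using R_mult R_in by blast+
  then show ?thesis using assms by (simp add: quot_mult_def lcoset_kernel coset_eq R_sym)
qed

lemma comm_loop_quotient:
  "comm_loop (quot_carrier S m {a. a \<approx> e}) (quot_mult m {a. a \<approx> e}) {a. a \<approx> e}"
proof -
  let ?q = "quot_mult m {a. a \<approx> e}"
  have N: "{a. a \<approx> e} = coset e" using R_sym by (auto simp: coset_def)
  have bij: "bij_betw (?q (coset a)) (coset ` S) (coset ` S)" if a: "a \<in> S" for a
  proof (rule bij_betw_imageI)
    show "inj_on (?q (coset a)) (coset ` S)"
      using a R_cancel[OF a] by (auto simp: inj_on_def quot_mult_kernel coset_eq)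
    show "?q (coset a) ` coset ` S = coset ` S"
    proof (intro equalityI subsetI)
      fix X assume "X \<in> coset ` S"
      then obtain b where b: "b \<in> S" "X = coset b" by blast
      obtain c where "c \<in> S" "a \<cdot> c = b" using divide[OF a b(1)] by blast
      then have "?q (coset a) (coset c) = X" "c \<in> S" using a b by (simp_all add: quot_mult_kernel)
      then show "X \<in> ?q (coset a) ` coset ` S" by blast
    qed (use a in \<open>auto simp: quot_mult_kernel\<close>)
  qed
  have comm': "?q X Y = ?q Y X" if "X \<in> coset ` S" "Y \<in> coset ` S" for X Y
    using that comm by (auto simp: quot_mult_kernel)
  have "bij_betw (\<lambda>b. ?q b X) (coset ` S) (coset ` S)" if X: "X \<in> coset ` S" for X
  proof -
    have "bij_betw (\<lambda>b. ?q b X) (coset ` S) (coset ` S) \<longleftrightarrow> bij_betw (?q X) (coset ` S) (coset ` S)"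
      using comm' X by (intro bij_betw_cong) blast
    then show ?thesis using bij X by blast
  qed
  moreover have "?q {a. a \<approx> e} X = X \<and> ?q X {a. a \<approx> e} = X" if X: "X \<in> coset ` S" for X
  proof -
    obtain a where "a \<in> S" "X = coset a" using X by blast
    then show ?thesis
      using quot_mult_kernel[of e a] quot_mult_kernel[of a e] by (simp flip: N)
  qed
  moreover have "{a. a \<approx> e} \<in> coset ` S" using N by auto
  moreover have "bij_betw (?q X) (coset ` S) (coset ` S)" if "X \<in> coset ` S" for X
    using that bij by blast
  ultimately show ?thesis
    unfolding comm_loop_def commutative_loop_def loop_def quot_carrier_kernel
    by (intro conjI ballI comm') simp_all
qed

text \<open>This links the coset-based series to congruences: the coset loop of the kernel is
  commutative, so \<open>center_eq\<close> applies to it and unfolds to associativity modulo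
  \<open>\<approx>\<close>.\<close>

lemma upper_central_Suc_eq:
  assumes "upper_central S m e i = {a. a \<approx> e}"
  shows "upper_central S m e (Suc i) = nucleus"
proof -
  interpret Q: comm_loop "quot_carrier S m {a. a \<approx> e}" "quot_mult m {a. a \<approx> e}" "{a. a \<approx> e}"
    by (rule comm_loop_quotient)
  have "lcoset m a {a. a \<approx> e} \<in> center (quot_carrier S m {a. a \<approx> e}) (quot_mult m {a. a \<approx> e}) {a. a \<approx> e}
        \<longleftrightarrow> a \<in> nucleus" if a: "a \<in> S" for a
    using a unfolding Q.center_eq lcoset_kernel[OF a] nucleus_def
    by (auto simp: quot_carrier_kernel quot_mult_kernel coset_eq)
  then show ?thesis using nucleus_in by (auto simp: assms)
qed

lemma nucleus_total:
  assumes "S = {a. a \<approx> e}"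
  shows "nucleus = S"
proof -
  have "a \<approx> b" if "a \<in> S" "b \<in> S" for a b
    using that assms R_sym R_trans by blast
  then show ?thesis unfolding nucleus_def by blast
qed

end

section \<open>Inverses, powers, associators and the tower of central quotients\<close>

context comm_loop begin

lemma linv:
  assumes "a \<in> S"
  shows "linv S m e a \<in> S" "a \<cdot> linv S m e a = e"
proof -
  have "\<exists>!b. b \<in> S \<and> a \<cdot> b = e" using divide[OF assms unit_in] left_cancel assms by metis
  from theI'[OF this] show "linv S m e a \<in> S" "a \<cdot> linv S m e a = e"
    unfolding linv_def by blast+
qed

lemma npow_in [simp, intro]: "a \<in> S \<Longrightarrow> npow m e a n \<in> S"
  by (induction n) auto

lemma ipow_in [simp, intro]: "a \<in> S \<Longrightarrow> ipow S m e a n \<in> S"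
  by (simp add: ipow_def linv)

lemma associator:
  assumes "a \<in> S" "b \<in> S" "c \<in> S"
  shows "associator S m a b c \<in> S" "(a \<cdot> b) \<cdot> c = (a \<cdot> (b \<cdot> c)) \<cdot> associator S m a b c"
proof -
  have "\<exists>!z. z \<in> S \<and> (a \<cdot> b) \<cdot> c = (a \<cdot> (b \<cdot> c)) \<cdot> z"
    using divide[of "a \<cdot> (b \<cdot> c)" "(a \<cdot> b) \<cdot> c"] left_cancel[of "a \<cdot> (b \<cdot> c)"] assms by (metis closed)
  from theI'[OF this]
  show "associator S m a b c \<in> S" "(a \<cdot> b) \<cdot> c = (a \<cdot> (b \<cdot> c)) \<cdot> associator S m a b c"
    unfolding associator_def by blast+
qed

lemma associator_eqI:
  assumes "a \<in> S" "b \<in> S" "c \<in> S" "z \<in> S" "(a \<cdot> b) \<cdot> c = (a \<cdot> (b \<cdot> c)) \<cdot> z"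
  shows "associator S m a b c = z"
proof -
  have "(a \<cdot> (b \<cdot> c)) \<cdot> associator S m a b c = (a \<cdot> (b \<cdot> c)) \<cdot> z"
    using associator(2)[OF assms(1-3)] assms(5) by simp
  then show ?thesis
    using left_cancel[of "a \<cdot> (b \<cdot> c)"] associator(1)[OF assms(1-3)] assms by blast
qed

text \<open>Equality is restricted to \<open>S\<close> because a congruence relates only elements of
  the carrier; it is the bottom of the tower.\<close>

definition eq_on :: "'a \<Rightarrow> 'a \<Rightarrow> bool" where "eq_on a b \<longleftrightarrow> a \<in> S \<and> a = b"

lemma loop_congruence_eq: "loop_congruence S m e eq_on"
  by unfold_locales (auto simp: eq_on_def)

text \<open>\<open>Z1\<close> and \<open>Z2\<close> are the first and second center,
  \<open>R1\<close> and \<open>R2\<close> the congruences modulo them.\<close>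

abbreviation "Z1 \<equiv> loop_congruence.nucleus S m eq_on"
abbreviation "R1 \<equiv> loop_congruence.extend S m eq_on Z1"
abbreviation "Z2 \<equiv> loop_congruence.nucleus S m R1"
abbreviation "R2 \<equiv> loop_congruence.extend S m R1 Z2"

lemma loop_congruence_R1: "loop_congruence S m e R1"
  using loop_congruence.loop_congruence_extend loop_congruence.central_subgroup_nucleus
    loop_congruence_eq by metis

lemma loop_congruence_R2: "loop_congruence S m e R2"
  using loop_congruence.loop_congruence_extend loop_congruence.central_subgroup_nucleus
    loop_congruence_R1 by metis

lemma nilpotency_class_le_3:
  "nilpotency_class_le S m e 3 \<longleftrightarrow> loop_congruence.nucleus S m R2 = S"
proof -
  interpret E0: loop_congruence S m e eq_on by (rule loop_congruence_eq)
  interpret E1: loop_congruence S m e R1 by (rule loop_congruence_R1)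
  interpret E2: loop_congruence S m e R2 by (rule loop_congruence_R2)
  have u0: "upper_central S m e 0 = {a. eq_on a e}" by (auto simp: eq_on_def)
  have u1: "upper_central S m e (Suc 0) = {a. R1 a e}"
    using E0.upper_central_Suc_eq[OF u0] E0.extend_nucleus_unit by simp
  have u2: "upper_central S m e (Suc (Suc 0)) = {a. R2 a e}"
    using E1.upper_central_Suc_eq[OF u1] E1.extend_nucleus_unit by simp
  have u3: "upper_central S m e (Suc (Suc (Suc 0))) = E2.nucleus"
    using E2.upper_central_Suc_eq[OF u2] .
  \<comment> \<open>The class may be smaller than three: once the series reaches \<open>S\<close> it
    stays there, so only the third term has to be examined.\<close>
  have 0: "upper_central S m e (Suc 0) = S" if "upper_central S m e 0 = S"
    using E0.nucleus_total E0.upper_central_Suc_eq[OF u0] that u0 by simp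
  have 1: "upper_central S m e (Suc (Suc 0)) = S" if "upper_central S m e (Suc 0) = S"
    using E1.nucleus_total E1.upper_central_Suc_eq[OF u1] that u1 by simp
  have 2: "upper_central S m e (Suc (Suc (Suc 0))) = S" if "upper_central S m e (Suc (Suc 0)) = S"
    using E2.nucleus_total E2.upper_central_Suc_eq[OF u2] that u2 by simp
  have "nilpotency_class_le S m e 3 \<longleftrightarrow>
      upper_central S m e 0 = S \<or> upper_central S m e (Suc 0) = S \<or>
      upper_central S m e (Suc (Suc 0)) = S \<or> upper_central S m e (Suc (Suc (Suc 0))) = S"
    unfolding nilpotency_class_le_def numeral_3_eq_3 by (metis le_SucE le_zero_eq le_SucI le_refl)
  then show ?thesis using 0 1 2 u3 by metis
qed

end

section \<open>Powers of central elements\<close>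

context loop_congruence begin

lemma npow_nucleus: "z \<in> nucleus \<Longrightarrow> npow m e z n \<in> nucleus"
  by (induction n) (auto intro: unit_nucleus nucleus_mult)

lemma ipow_nucleus: "z \<in> nucleus \<Longrightarrow> ipow S m e z n \<in> nucleus"
proof -
  assume z: "z \<in> nucleus"
  have p: "npow m e z k \<in> nucleus" "npow m e z k \<in> S" for k
    using npow_nucleus[OF z] nucleus_in by blast+
  then have "linv S m e (npow m e z k) \<in> nucleus" for k
    using nucleus_inverse[OF p(1)[of k] linv(1)[OF p(2)[of k]]] linv(2)[OF p(2)[of k]] by simp
  then show ?thesis using p by (simp add: ipow_def)
qed

lemma ipow_Suc:
  assumes z: "z \<in> nucleus"
  shows "ipow S m e z (k + 1) \<approx> z \<cdot> ipow S m e z k"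
proof (cases "k \<ge> 0")
  case True
  then have "nat (k + 1) = Suc (nat k)" by simp
  then show ?thesis using True nucleus_in[OF z] by (simp add: ipow_def)
next
  case False
  have zS: "z \<in> S" using z nucleus_in by blast
  \<comment> \<open>Chosen so that \<open>k\<close> and \<open>k + 1\<close> have absolute values
    \<open>n + 1\<close> and \<open>n\<close>. For \<open>n = 0\<close> the exponent
    \<open>k + 1\<close> falls in the nonnegative branch of \<open>ipow\<close>, which agrees
    because the inverse of \<open>e\<close> is \<open>e\<close>.\<close>
  define n where "n = nat (- k - 1)"
  have n: "nat (- k) = Suc n" "nat (- (k + 1)) = n" using False by (auto simp: n_def)
  let ?p = "npow m e z n"
  have k: "ipow S m e z k = linv S m e (z \<cdot> ?p)" using False n by (simp add: ipow_def)
  have k1: "ipow S m e z (k + 1) = linv S m e ?p"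
  proof (cases "k + 1 = 0")
    case True
    then have "n = 0" by (simp add: n_def)
    moreover have "linv S m e e = e" using linv[of e] by simp
    ultimately show ?thesis using True by (simp add: ipow_def)
  qed (use False n in \<open>simp add: ipow_def\<close>)
  let ?l = "linv S m e (z \<cdot> ?p)"
  have lS: "?l \<in> S" "(z \<cdot> ?p) \<cdot> ?l = e" "linv S m e ?p \<in> S" "?p \<cdot> linv S m e ?p = e"
    using linv zS by auto
  have "?p \<cdot> (z \<cdot> ?l) \<approx> (?p \<cdot> z) \<cdot> ?l" using R_sym nucleus_mid z zS lS by blast
  also have "(?p \<cdot> z) \<cdot> ?l = ?p \<cdot> linv S m e ?p" using lS comm zS by simp
  finally have "z \<cdot> ?l \<approx> linv S m e ?p"
    by (rule R_cancel[rotated -1]) (use zS lS in auto)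
  then show ?thesis unfolding k k1 by (rule R_sym)
qed

lemma ipow_add:
  assumes z: "z \<in> nucleus"
  shows "ipow S m e z (k + l) \<approx> ipow S m e z k \<cdot> ipow S m e z l"
proof -
  have zS: "z \<in> S" using z nucleus_in by blast
  have eq: "ipow S m e z 0 = e" by (simp add: ipow_def)
  have step: "z \<cdot> ipow S m e z (k + l) \<approx> (z \<cdot> ipow S m e z k) \<cdot> ipow S m e z l \<longleftrightarrow>
      ipow S m e z (k + l) \<approx> ipow S m e z k \<cdot> ipow S m e z l" (is "?L \<longleftrightarrow> ?R") for k
  proof
    have n: "(z \<cdot> ipow S m e z k) \<cdot> ipow S m e z l \<approx> z \<cdot> (ipow S m e z k \<cdot> ipow S m e z l)"
      using nucleusD z zS by blast
    show ?R if ?L using R_cancel[OF zS _ _ R_trans[OF that n]] zS by blast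
    show ?L if ?R using R_trans[OF R_left[OF zS that] R_sym[OF n]] .
  qed
  \<comment> \<open>An equivalence, so that it serves both the upward and the downward half of the
    integer induction.\<close>
  have step': "ipow S m e z (k + 1 + l) \<approx> ipow S m e z (k + 1) \<cdot> ipow S m e z l \<longleftrightarrow>
      ipow S m e z (k + l) \<approx> ipow S m e z k \<cdot> ipow S m e z l" for k
  proof -
    have a: "ipow S m e z (k + 1 + l) \<approx> z \<cdot> ipow S m e z (k + l)"
      using ipow_Suc[OF z, of "k + l"] by (simp add: algebra_simps)
    have b: "ipow S m e z (k + 1) \<cdot> ipow S m e z l \<approx> (z \<cdot> ipow S m e z k) \<cdot> ipow S m e z l"
      using R_right[OF _ ipow_Suc[OF z]] zS by blast
    show ?thesis unfolding step[of k, symmetric]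
      using R_trans[OF R_trans[OF R_sym[OF a]] b] R_trans[OF R_trans[OF a] R_sym[OF b]] by blast
  qed
  show ?thesis
  proof (induction k rule: int_induct[where k = 0])
    case base
    then show ?case using eq zS by simp
  next
    case (step1 i)
    then show ?case using step' by blast
  next
    case (step2 i)
    then show ?case using step'[of "i - 1"] by simp
  qed
qed

text \<open>Closed under \<open>\<approx>\<close> because exponents add only modulo
  \<open>\<approx>\<close>, whereas \<open>central_subgroup\<close> asks for products to lie in the
  set itself.\<close>

definition power_class :: "'a \<Rightarrow> 'a set" where
  "power_class z = {c. \<exists>n. c \<approx> ipow S m e z n}"

lemma central_subgroup_power_class:
  assumes z: "z \<in> nucleus"
  shows "central_subgroup (power_class z)"
  unfolding central_subgroup_def
proof (intro conjI ballI subsetI)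
  have zS: "z \<in> S" using z nucleus_in by blast
  have eq: "ipow S m e z 0 = e" by (simp add: ipow_def)
  show "c \<in> nucleus" if "c \<in> power_class z" for c
    using that nucleus_saturated[OF ipow_nucleus[OF z]] R_sym unfolding power_class_def by blast
  show "e \<in> power_class z" unfolding power_class_def using eq R_refl[OF unit_in] by (metis CollectI)
  fix c assume "c \<in> power_class z"
  then obtain n where n: "c \<approx> ipow S m e z n" unfolding power_class_def by blast
  show "c \<cdot> d \<in> power_class z" if d: "d \<in> power_class z" for d
  proof -
    obtain l where l: "d \<approx> ipow S m e z l" using d unfolding power_class_def by blast
    have "c \<cdot> d \<approx> ipow S m e z (n + l)"
      using R_trans[OF R_mult[OF n l] R_sym[OF ipow_add[OF z]]] .
    then show ?thesis by (auto simp: power_class_def)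
  qed
  have "c \<cdot> ipow S m e z (- n) \<approx> ipow S m e z n \<cdot> ipow S m e z (- n)"
    using R_right n zS by blast
  also have "\<dots> \<approx> ipow S m e z (n + - n)" using R_sym[OF ipow_add[OF z]] .
  also have "\<dots> = e" using eq by simp
  finally show "\<exists>l\<in>power_class z. c \<cdot> l \<approx> e"
    using zS by (intro bexI[of _ "ipow S m e z (- n)"]) (auto simp: power_class_def)
qed

lemma extend_power_class:
  "extend (power_class z) a b \<Longrightarrow> \<exists>n. b \<approx> a \<cdot> ipow S m e z n"
  unfolding extend_def power_class_def using R_trans R_left by blast

lemma extend_mono:
  assumes "central_subgroup K" "a \<approx> b"
  shows "extend K a b"
  using extendI[of a e K b] assms R_in R_sym unfolding central_subgroup_def by simp

lemma extend_power:
  assumes "z \<in> S"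
  shows "extend (power_class z) e z"
proof (rule extendI)
  have "ipow S m e z 1 = z" using assms by (simp add: ipow_def)
  then show "z \<in> power_class z"
    using assms R_refl unfolding power_class_def by (metis CollectI)
qed (use assms in auto)

end

section \<open>The loop on eight integers\<close>

text \<open>The division in \<open>alpha\<close> is exact, as the residues of \<open>k\<close>
  modulo 3 show.\<close>

lemma three_alpha: "3 * alpha k = k ^ 3 - k"
proof -
  define n where "n = k div 3"
  have "k = 3 * n \<or> k = 3 * n + 1 \<or> k = 3 * n + 2" unfolding n_def by presburger
  then have "k ^ 3 - k = 3 * (9 * n ^ 3 - n) \<or> k ^ 3 - k = 3 * (9 * n ^ 3 + 9 * n ^ 2 + 2 * n) \<or>
      k ^ 3 - k = 3 * (9 * n ^ 3 + 18 * n ^ 2 + 11 * n + 2)"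
    by (elim disjE) (simp_all add: algebra_simps power2_eq_square power3_eq_cube)
  then have "3 dvd k ^ 3 - k" by (metis dvd_triv_left)
  then show ?thesis unfolding alpha_def by simp
qed

text \<open>Removes \<open>alpha\<close> from sums, so that coordinate identities become polynomial
  identities with the remaining values of \<open>alpha\<close> as atoms.\<close>

lemma alpha_add: "alpha (i + j) = alpha i + alpha j + i * i * j + i * j * j"
proof -
  have "3 * alpha (i + j) = 3 * (alpha i + alpha j + i * i * j + i * j * j)"
    unfolding distrib_left three_alpha by (simp add: algebra_simps power3_eq_cube)
  then show ?thesis by simp
qed

lemma alpha_small [simp]: "alpha 0 = 0" "alpha 1 = 0"
  by (simp_all add: alpha_def)

lemma star_Cons:
  "star [a1,a2,a3,a4,a5,a6,a7,a8] [b1,b2,b3,b4,b5,b6,b7,b8] =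
   [a1 + b1,
    a2 + b2,
    a3 + b3 - a1*b1*(a2 + b2),
    a4 + b4 + a2*b2*(a1 + b1),
    a5 + b5 + (a2 + b2)*(b1*alpha a1 + a1*alpha b1) + a2*(a1*(b1*b1-b1) + b1*b1*(a1*a1-a1))
      + b2*(b1*(a1*a1-a1) + a1*a1*(b1*b1-b1)) - a1*b1*(a3 + b3),
    a6 + b6 + 2*a1*a2*b1*b2*(a1 + b1) + (a2 + b2)*(a1*(b1*b1-b1) + b1*(a1*a1-a1))
      + (a2*a2-a2 + (b2*b2-b2))*(a1*b1*b1 + b1*a1*a1)
      - a2*b2*alpha (a1 + b1) - a1*b1*(a4 + b4) - (a3 + b3)*(a1*b2 + a2*b1),
    a7 + b7 - 2*a1*a2*b1*b2*(a2 + b2) - (a1 + b1)*(a2*(b2*b2-b2) + b2*(a2*a2-a2))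
      - (a1*a1-a1 + (b1*b1-b1))*(a2*b2*b2 + b2*a2*a2)
      + a1*b1*alpha (a2 + b2) - a2*b2*(a3 + b3) - (a4 + b4)*(a1*b2 + a2*b1),
    a8 + b8 - (a1 + b1)*(a2*alpha b2 + b2*alpha a2) - a1*(a2*(b2*b2-b2) + b2*b2*(a2*a2-a2))
      - b1*(b2*(a2*a2-a2) + a2*a2*(b2*b2-b2)) - a2*b2*(a4 + b4)]"
  by (simp add: star_def Let_def beta_def power2_eq_square mult.assoc)

section \<open>Loop structure on the tuples\<close>

definition zero8 :: "int list" where "zero8 = [0,0,0,0,0,0,0,0]"

lemma Z8_cases:
  assumes "a \<in> Z8"
  obtains a1 a2 a3 a4 a5 a6 a7 a8 where "a = [a1,a2,a3,a4,a5,a6,a7,a8]"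
  using assms unfolding Z8_def by (auto simp: numeral_eq_Suc length_Suc_conv)

lemma Z8_Cons [simp]: "[a1,a2,a3,a4,a5,a6,a7,a8] \<in> Z8"
  by (simp add: Z8_def)

lemma star_comm:
  assumes "a \<in> Z8" "b \<in> Z8"
  shows "star a b = star b a"
proof -
  obtain a1 a2 a3 a4 a5 a6 a7 a8 where a: "a = [a1,a2,a3,a4,a5,a6,a7,a8]" using Z8_cases assms by blast
  obtain b1 b2 b3 b4 b5 b6 b7 b8 where b: "b = [b1,b2,b3,b4,b5,b6,b7,b8]" using Z8_cases assms by blast
  show ?thesis unfolding a b star_Cons by (simp add: alpha_add algebra_simps)
qed

lemma bij_star:
  assumes "a \<in> Z8"
  shows "bij_betw (star a) Z8 Z8"
proof -
  obtain a1 a2 a3 a4 a5 a6 a7 a8 where a: "a = [a1,a2,a3,a4,a5,a6,a7,a8]" using Z8_cases assms by blast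
  have inj: "inj_on (star a) Z8"
  proof (rule inj_onI)
    fix b c assume "b \<in> Z8" "c \<in> Z8" "star a b = star a c"
    then show "b = c" by (elim Z8_cases) (simp add: a star_Cons)
  qed
  have "\<exists>d\<in>Z8. star a d = r" if rZ: "r \<in> Z8" for r
  proof -
    obtain r1 r2 r3 r4 r5 r6 r7 r8 where r: "r = [r1,r2,r3,r4,r5,r6,r7,r8]" using Z8_cases[OF rZ] by blast
    \<comment> \<open>The system is triangular: coordinate \<open>i\<close> of the product is the
      unknown \<open>di\<close> plus terms in earlier unknowns. Each unknown is thus the target
      minus the product evaluated with that unknown set to 0.\<close>
    define d1 where "d1 = r1 - a1"
    define d2 where "d2 = r2 - a2"
    define d3 where "d3 = r3 - star a [d1,d2,0,0,0,0,0,0] ! 2"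
    define d4 where "d4 = r4 - star a [d1,d2,0,0,0,0,0,0] ! 3"
    define d5 where "d5 = r5 - star a [d1,d2,d3,d4,0,0,0,0] ! 4"
    define d6 where "d6 = r6 - star a [d1,d2,d3,d4,0,0,0,0] ! 5"
    define d7 where "d7 = r7 - star a [d1,d2,d3,d4,0,0,0,0] ! 6"
    define d8 where "d8 = r8 - star a [d1,d2,d3,d4,0,0,0,0] ! 7"
    have "a1 + d1 = r1" "a2 + d2 = r2" by (simp_all add: d1_def d2_def)
    then have "star a [d1,d2,d3,d4,d5,d6,d7,d8] = r"
      using d3_def d4_def d5_def d6_def d7_def d8_def unfolding a r star_Cons by simp
    then show ?thesis by (intro bexI) auto
  qed
  moreover have "star a d \<in> Z8" for d by (simp add: star_def Let_def Z8_def)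
  ultimately have "star a ` Z8 = Z8" by blast
  with inj show ?thesis by (simp add: bij_betw_def)
qed

lemma star_in_Z8 [simp]: "star a d \<in> Z8" by (simp add: star_def Let_def Z8_def)

interpretation Z8: comm_loop Z8 star zero8
proof
  have u: "star zero8 a = a" if "a \<in> Z8" for a
    using that by (elim Z8_cases) (simp add: star_Cons zero8_def)
  have "bij_betw (\<lambda>b. star b a) Z8 Z8" if "a \<in> Z8" for a
  proof -
    have "bij_betw (\<lambda>b. star b a) Z8 Z8 \<longleftrightarrow> bij_betw (star a) Z8 Z8"
      using that by (intro bij_betw_cong) (rule star_comm)
    then show ?thesis using bij_star that by blast
  qed
  moreover have "zero8 \<in> Z8" by (simp add: zero8_def)
  ultimately show "commutative_loop Z8 star zero8"
    unfolding commutative_loop_def loop_def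
    using u bij_star star_comm[of _ zero8] by (intro conjI ballI star_comm) simp_all
qed

text \<open>Every inner mapping given by \<open>a\<close>, \<open>b\<close> has this shape with \<open>i\<close>, \<open>j\<close>, \<open>k\<close>, \<open>l\<close> the products
  \<open>a1 b1\<close>, \<open>a1 b2\<close>, \<open>a2 b1\<close>, \<open>a2 b2\<close>; \<open>p\<close> and \<open>q\<close> are the central displacements of the two generators.\<close>

definition inner8 :: "int \<Rightarrow> int \<Rightarrow> int \<Rightarrow> int \<Rightarrow> (nat \<Rightarrow> int) \<Rightarrow> (nat \<Rightarrow> int) \<Rightarrow> int list \<Rightarrow> int list" where
  "inner8 i j k l p q c = (let
     c1 = c!0; c2 = c!1; c3 = c!2; c4 = c!3; c5 = c!4; c6 = c!5; c7 = c!6; c8 = c!7 in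
    [c1,
     c2,
     c3 + j*c1 - i*c2,
     c4 + l*c1 - k*c2,
     c5 + p 5*c1 + q 5*c2 - i*c3 - j*alpha c1,
     c6 + p 6*c1 + q 6*c2 + i*c1*c2*c2 - j*c1*c1*c2 - i*c4 - (j + k)*c3 - l*alpha c1,
     c7 + p 7*c1 + q 7*c2 + k*c1*c2*c2 - l*c1*c1*c2 - l*c3 - (j + k)*c4 + i*alpha c2,
     c8 + p 8*c1 + q 8*c2 - l*c4 + k*alpha c2])"

lemma inner8_Cons:
  "inner8 i j k l p q [c1,c2,c3,c4,c5,c6,c7,c8] =
    [c1,
     c2,
     c3 + j*c1 - i*c2,
     c4 + l*c1 - k*c2,
     c5 + p 5*c1 + q 5*c2 - i*c3 - j*alpha c1,
     c6 + p 6*c1 + q 6*c2 + i*c1*c2*c2 - j*c1*c1*c2 - i*c4 - (j + k)*c3 - l*alpha c1,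
     c7 + p 7*c1 + q 7*c2 + k*c1*c2*c2 - l*c1*c1*c2 - l*c3 - (j + k)*c4 + i*alpha c2,
     c8 + p 8*c1 + q 8*c2 - l*c4 + k*alpha c2]"
  by (simp add: inner8_def Let_def)

lemma inner8_in_Z8 [simp]: "inner8 i j k l p q c \<in> Z8"
  by (simp add: inner8_def Let_def Z8_def)

lemma inner8_hom:
  assumes "c \<in> Z8" "d \<in> Z8"
  shows "inner8 i j k l p q (star c d) = star (inner8 i j k l p q c) (inner8 i j k l p q d)"
proof -
  obtain c1 c2 c3 c4 c5 c6 c7 c8 where c: "c = [c1,c2,c3,c4,c5,c6,c7,c8]" using Z8_cases assms by blast
  obtain d1 d2 d3 d4 d5 d6 d7 d8 where d: "d = [d1,d2,d3,d4,d5,d6,d7,d8]" using Z8_cases assms by blast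
  show ?thesis
    unfolding c d star_Cons inner8_Cons list.inject alpha_add
    by (intro conjI refl; algebra)
qed

lemma star_inner8:
  assumes "a \<in> Z8" "b \<in> Z8"
  shows "\<exists>i j k l p q. \<forall>c\<in>Z8. star (star b a) (inner8 i j k l p q c) = star b (star a c)"
proof -
  obtain a1 a2 a3 a4 a5 a6 a7 a8 where a: "a = [a1,a2,a3,a4,a5,a6,a7,a8]" using Z8_cases assms by blast
  obtain b1 b2 b3 b4 b5 b6 b7 b8 where b: "b = [b1,b2,b3,b4,b5,b6,b7,b8]" using Z8_cases assms by blast
  \<comment> \<open>As \<open>alpha 0 = alpha 1 = 0\<close>, the values of \<open>p\<close> and
    \<open>q\<close> at 5 to 8 are the last four coordinates of the images under
    \<open>inner8\<close> of the first and second unit vector.\<close>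
  define p :: "nat \<Rightarrow> int" where "p = (\<lambda>_. 0)
    (5 := - b2*alpha a1 + a1*b2 - a1*a1*b1*b2 + a1*b3,
     6 := - a1*a1*a2*b2 - a1*a1*b2*b2 - 2*a1*a2*b1*b2 - a1*b1*b2*b2 + 2*a1*b2 + a1*b4 + a2*b3,
     7 := - a1*alpha b2 - a1*a2*a2*b2 - 2*a1*a2*b2*b2 - a2*a2*b1*b2 - a2*b1*b2*b2 + 2*a2*b2 + a2*b4,
     8 := - b2*alpha a2 - a2*alpha b2 + a2*b2 - a2*a2*b2*b2)"
  have p: "p 5 = - b2*alpha a1 + a1*b2 - a1*a1*b1*b2 + a1*b3"
     "p 6 = - a1*a1*a2*b2 - a1*a1*b2*b2 - 2*a1*a2*b1*b2 - a1*b1*b2*b2 + 2*a1*b2 + a1*b4 + a2*b3"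
     "p 7 = - a1*alpha b2 - a1*a2*a2*b2 - 2*a1*a2*b2*b2 - a2*a2*b1*b2 - a2*b1*b2*b2 + 2*a2*b2 + a2*b4"
     "p 8 = - b2*alpha a2 - a2*alpha b2 + a2*b2 - a2*a2*b2*b2"
    by (simp_all add: p_def)
  define q :: "nat \<Rightarrow> int" where "q = (\<lambda>_. 0)
    (5 := b1*alpha a1 + a1*alpha b1 - a1*b1 + a1*a1*b1*b1,
     6 := a1*a1*a2*b1 + a1*a1*b1*b2 + 2*a1*a2*b1*b1 - 2*a1*b1 + a1*b1*b1*b2 + a1*b3 + a2*alpha b1,
     7 := a1*a2*a2*b1 + 2*a1*a2*b1*b2 + a1*b4 + a2*a2*b1*b1 - 2*a2*b1 + a2*b1*b1*b2 + a2*b3,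
     8 := b1*alpha a2 + a2*a2*b1*b2 - a2*b1 + a2*b4)"
  have q: "q 5 = b1*alpha a1 + a1*alpha b1 - a1*b1 + a1*a1*b1*b1"
     "q 6 = a1*a1*a2*b1 + a1*a1*b1*b2 + 2*a1*a2*b1*b1 - 2*a1*b1 + a1*b1*b1*b2 + a1*b3 + a2*alpha b1"
     "q 7 = a1*a2*a2*b1 + 2*a1*a2*b1*b2 + a1*b4 + a2*a2*b1*b1 - 2*a2*b1 + a2*b1*b1*b2 + a2*b3"
     "q 8 = b1*alpha a2 + a2*a2*b1*b2 - a2*b1 + a2*b4"
    by (simp_all add: q_def)
  have "star (star b a) (inner8 (a1*b1) (a1*b2) (a2*b1) (a2*b2) p q c) = star b (star a c)" if "c \<in> Z8" for c
  proof -
    obtain c1 c2 c3 c4 c5 c6 c7 c8 where c: "c = [c1,c2,c3,c4,c5,c6,c7,c8]" using Z8_cases \<open>c \<in> Z8\<close> by blast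
    show ?thesis
      unfolding a b c star_Cons inner8_Cons p q list.inject alpha_add
      by (intro conjI refl; algebra)
  qed
  then show ?thesis by blast
qed

text \<open>By cancellation the images \<open>c'\<close> and \<open>d'\<close> can only be the
  values of \<open>inner8\<close>, which is multiplicative.\<close>

lemma Z8_lam_hom: Z8.lam_hom
  unfolding Z8.lam_hom_def
proof (intro ballI impI)
  fix a b c d c' d'
  assume S: "a \<in> Z8" "b \<in> Z8" "c \<in> Z8" "d \<in> Z8" "c' \<in> Z8" "d' \<in> Z8"
    and eq: "star (star b a) c' = star b (star a c)" "star (star b a) d' = star b (star a d)"
  obtain i j k l p q where f: "\<And>c. c \<in> Z8 \<Longrightarrow> star (star b a) (inner8 i j k l p q c) = star b (star a c)"
    using star_inner8[OF S(1,2)] by blast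
  have "c' = inner8 i j k l p q c" "d' = inner8 i j k l p q d"
    using f[OF S(3)] f[OF S(4)] eq S Z8.left_cancel[of "star b a"] inner8_in_Z8 star_in_Z8 by metis+
  then show "star (star b a) (star c' d') = star b (star a (star c d))"
    using f[of "star c d"] S by (simp add: inner8_hom)
qed

text \<open>Here and in \<open>Z8_nucleus2\<close> one inclusion is enough: large first and second
  centers bound the class from above.\<close>

lemma Z8_nucleus1: "[0,0,0,0,k5,k6,k7,k8] \<in> Z8.Z1"
proof -
  interpret E0: loop_congruence Z8 star zero8 Z8.eq_on by (rule Z8.loop_congruence_eq)
  show ?thesis unfolding E0.nucleus_def Z8.eq_on_def
    by (auto elim!: Z8_cases simp: star_Cons algebra_simps)
qed

lemma Z8_R1:
  "Z8.R1 [a1,a2,a3,a4,a5,a6,a7,a8] [a1,a2,a3,a4,b5,b6,b7,b8]"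
proof -
  interpret E0: loop_congruence Z8 star zero8 Z8.eq_on by (rule Z8.loop_congruence_eq)
  show ?thesis
    by (rule E0.extendI[OF _ Z8_nucleus1[of "b5 - a5" "b6 - a6" "b7 - a7" "b8 - a8"]])
      (simp_all add: star_Cons Z8.eq_on_def)
qed

lemma Z8_nucleus2: "[0,0,k3,k4,k5,k6,k7,k8] \<in> Z8.Z2"
proof -
  interpret E1: loop_congruence Z8 star zero8 Z8.R1 by (rule Z8.loop_congruence_R1)
  have "Z8.R1 (star (star [0,0,k3,k4,k5,k6,k7,k8] b) c) (star [0,0,k3,k4,k5,k6,k7,k8] (star b c))"
    if bc: "b \<in> Z8" "c \<in> Z8" for b c
  proof -
    \<comment> \<open>Equality of coordinates becomes a premise, so that applying the rule leaves
      polynomial identities as goals.\<close>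
    have R1: "Z8.R1 [a1,a2,a3,a4,a5,a6,a7,a8] [b1,b2,b3,b4,b5,b6,b7,b8]"
      if "a1 = b1" "a2 = b2" "a3 = b3" "a4 = b4" for a1 a2 a3 a4 a5 a6 a7 a8 b1 b2 b3 b4 b5 b6 b7 b8
      unfolding that by (rule Z8_R1)
    obtain b1 b2 b3 b4 b5 b6 b7 b8 where b: "b = [b1,b2,b3,b4,b5,b6,b7,b8]" using Z8_cases[OF bc(1)] by blast
    obtain c1 c2 c3 c4 c5 c6 c7 c8 where c: "c = [c1,c2,c3,c4,c5,c6,c7,c8]" using Z8_cases[OF bc(2)] by blast
    show ?thesis unfolding b c star_Cons
      by (rule R1) algebra+
  qed
  then show ?thesis by (simp add: E1.nucleus_def)
qed

lemma Z8_R2: "Z8.R2 [a1,a2,a3,a4,a5,a6,a7,a8] [a1,a2,b3,b4,b5,b6,b7,b8]"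
proof -
  interpret E1: loop_congruence Z8 star zero8 Z8.R1 by (rule Z8.loop_congruence_R1)
  show ?thesis
  proof (rule E1.extendI[OF _ Z8_nucleus2[of "b3 - a3" "b4 - a4" 0 0 0 0]])
    show "Z8.R1 [a1,a2,b3,b4,b5,b6,b7,b8] (star [a1,a2,a3,a4,a5,a6,a7,a8] [0,0,b3 - a3,b4 - a4,0,0,0,0])"
      unfolding star_Cons by (simp add: Z8_R1)
  qed simp
qed

lemma CAL3_Z8: "CAL3 Z8 star zero8"
proof -
  interpret E2: loop_congruence Z8 star zero8 Z8.R2 by (rule Z8.loop_congruence_R2)
  have "Z8.R2 (star (star a b) c) (star a (star b c))" if abc: "a \<in> Z8" "b \<in> Z8" "c \<in> Z8" for a b c
  proof -
    obtain a1 a2 a3 a4 a5 a6 a7 a8 where a: "a = [a1,a2,a3,a4,a5,a6,a7,a8]" using Z8_cases[OF abc(1)] by blast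
    obtain b1 b2 b3 b4 b5 b6 b7 b8 where b: "b = [b1,b2,b3,b4,b5,b6,b7,b8]" using Z8_cases[OF abc(2)] by blast
    obtain c1 c2 c3 c4 c5 c6 c7 c8 where c: "c = [c1,c2,c3,c4,c5,c6,c7,c8]" using Z8_cases[OF abc(3)] by blast
    \<comment> \<open>Reassociating the two sums makes the first two coordinates literally equal, as
      \<open>Z8_R2\<close> demands.\<close>
    show ?thesis unfolding a b c star_Cons add.assoc[of a1 b1 c1] add.assoc[of a2 b2 c2] by (rule Z8_R2)
  qed
  then have "E2.nucleus = Z8" by (auto simp: E2.nucleus_def)
  then show ?thesis
    unfolding CAL3_def Z8.nilpotency_class_le_3
    using Z8.commutative_loop Z8.lam_hom_imp_automorphic[OF Z8_lam_hom] by blast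
qed

section \<open>Generation and associativity modulo a congruence\<close>

lemma (in comm_loop) subloopI:
  assumes "T \<subseteq> S" "e \<in> T" "\<And>a b. a \<in> T \<Longrightarrow> b \<in> T \<Longrightarrow> a \<cdot> b \<in> T"
    "\<And>a b. a \<in> T \<Longrightarrow> b \<in> S \<Longrightarrow> a \<cdot> b \<in> T \<Longrightarrow> b \<in> T"
  shows "subloop S m e T"
  unfolding subloop_def using assms comm by (metis subsetD)

lemma (in comm_loop) automorphism_associator:
  assumes "automorphism S m f" "a \<in> S" "b \<in> S" "c \<in> S"
  shows "f (associator S m a b c) = associator S m (f a) (f b) (f c)"
proof -
  note f = automorphismD(2,3)[OF assms(1)]
  have "(f a \<cdot> f b) \<cdot> f c = f ((a \<cdot> b) \<cdot> c)" using assms f by simp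
  also have "\<dots> = (f a \<cdot> (f b \<cdot> f c)) \<cdot> f (associator S m a b c)"
    unfolding associator(2)[OF assms(2-4)] using assms f associator(1)[OF assms(2-4)] by simp
  finally show ?thesis
    by (intro associator_eqI[symmetric] f associator assms)
qed

text \<open>One link of the chain behind the normal form: \<open>z\<close> is made trivial, and the
  last property recovers the finer relation at the cost of one exponent.\<close>

lemma (in comm_loop) extend_by_power:
  assumes "loop_congruence S m e R" "z \<in> loop_congruence.nucleus S m R"
  obtains R' where "loop_congruence S m e R'" "\<And>a b. R a b \<Longrightarrow> R' a b" "R' e z"
    "\<And>a b. R' a b \<Longrightarrow> \<exists>n. R b (a \<cdot> ipow S m e z n)"
proof -
  interpret loop_congruence S m e R by (rule assms(1))
  note K = central_subgroup_power_class[OF assms(2)]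
  show thesis
    by (rule that[OF loop_congruence_extend[OF K] extend_mono[OF K]
        extend_power[OF nucleus_in[OF assms(2)]] extend_power_class])
qed

text \<open>Carries centrality of the later generators up the chain of congruences.\<close>

lemma (in comm_loop) nucleus_mono:
  assumes "loop_congruence S m e R" "loop_congruence S m e R'" "\<And>a b. R a b \<Longrightarrow> R' a b"
  shows "loop_congruence.nucleus S m R \<subseteq> loop_congruence.nucleus S m R'"
  using assms(3) unfolding loop_congruence.nucleus_def[OF assms(1)] loop_congruence.nucleus_def[OF assms(2)]
  by blast

context loop_congruence begin

text \<open>The condition says that the automorphism L_{a,b} fixes \<open>c\<close> modulo
  \<open>\<approx>\<close>, and such fixed points are closed under products and division.\<close>

lemma subloop_lam_fixed:
  assumes lam_hom and S: "a \<in> S" "b \<in> S"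
  shows "subloop S m e {c \<in> S. (b \<cdot> a) \<cdot> c \<approx> b \<cdot> (a \<cdot> c)}"
proof -
  obtain f where f: "automorphism S m f" "\<And>c. c \<in> S \<Longrightarrow> (b \<cdot> a) \<cdot> f c = b \<cdot> (a \<cdot> c)"
    using lam_automorphism[OF assms] by blast
  note fS = automorphismD(2)[OF f(1)] and fm = automorphismD(3)[OF f(1)]
  have ba: "b \<cdot> a \<in> S" using S by blast
  have "{c \<in> S. (b \<cdot> a) \<cdot> c \<approx> b \<cdot> (a \<cdot> c)} = {c \<in> S. c \<approx> f c}"
    using f(2) R_left[OF ba] R_cancel[OF ba] fS by (metis (no_types, lifting))
  moreover have "subloop S m e {c \<in> S. c \<approx> f c}"
  proof (rule subloopI)
    show "e \<in> {c \<in> S. c \<approx> f c}" using automorphism_unit[OF f(1)] by simp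
    show "c \<cdot> d \<in> {c \<in> S. c \<approx> f c}" if "c \<in> {c \<in> S. c \<approx> f c}" "d \<in> {c \<in> S. c \<approx> f c}" for c d
      using that R_mult fm by simp
    show "d \<in> {c \<in> S. c \<approx> f c}" if "c \<in> {c \<in> S. c \<approx> f c}" "d \<in> S" "c \<cdot> d \<in> {c \<in> S. c \<approx> f c}" for c d
      using that R_cancel_mult[of c d "f c" "f d"] fm fS by simp
  qed auto
  ultimately show ?thesis by simp
qed

lemma subloop_middle_nucleus:
  "subloop S m e {b \<in> S. \<forall>a\<in>S. \<forall>c\<in>S. (a \<cdot> b) \<cdot> c \<approx> a \<cdot> (b \<cdot> c)}" (is "subloop S m e ?M")
proof (rule subloopI)
  have mult: "b \<cdot> b' \<in> ?M" if b: "b \<in> ?M" "b' \<in> ?M" for b b'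
  proof -
    have S: "b \<in> S" "b' \<in> S" using b by auto
    have M: "\<And>a c. a \<in> S \<Longrightarrow> c \<in> S \<Longrightarrow> (a \<cdot> b) \<cdot> c \<approx> a \<cdot> (b \<cdot> c)"
      and M': "\<And>a c. a \<in> S \<Longrightarrow> c \<in> S \<Longrightarrow> (a \<cdot> b') \<cdot> c \<approx> a \<cdot> (b' \<cdot> c)" using b by auto
    have "(a \<cdot> (b \<cdot> b')) \<cdot> c \<approx> a \<cdot> ((b \<cdot> b') \<cdot> c)" if ac: "a \<in> S" "c \<in> S" for a c
    proof -
      have "(a \<cdot> (b \<cdot> b')) \<cdot> c \<approx> ((a \<cdot> b) \<cdot> b') \<cdot> c"
        by (intro R_right R_sym[OF M] S ac)
      also have "\<dots> \<approx> (a \<cdot> b) \<cdot> (b' \<cdot> c)" by (intro M' closed S ac)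
      also have "\<dots> \<approx> a \<cdot> (b \<cdot> (b' \<cdot> c))" by (intro M closed S ac)
      also have "\<dots> \<approx> a \<cdot> ((b \<cdot> b') \<cdot> c)" by (intro R_left R_sym[OF M'] S ac)
      finally show ?thesis .
    qed
    then show ?thesis using S by simp
  qed
  then show "\<And>b b'. b \<in> ?M \<Longrightarrow> b' \<in> ?M \<Longrightarrow> b \<cdot> b' \<in> ?M" .
  fix b b' assume b: "b \<in> ?M" "b' \<in> S" "b \<cdot> b' \<in> ?M"
  have bS: "b \<in> S" and M: "\<And>a c. a \<in> S \<Longrightarrow> c \<in> S \<Longrightarrow> (a \<cdot> b) \<cdot> c \<approx> a \<cdot> (b \<cdot> c)" using b by auto
  \<comment> \<open>Division is reduced to products: \<open>b'\<close> is
    \<open>i \<cdot> (b \<cdot> b')\<close> modulo \<open>\<approx>\<close>, so it suffices that the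
    inverse \<open>i\<close> lies in the set.\<close>
  obtain i where i: "i \<in> S" "b \<cdot> i = e" using divide[OF bS unit_in] by blast
  have ib: "c \<approx> i \<cdot> (b \<cdot> c)" if "c \<in> S" for c
    using M[OF i(1) that] that i comm[OF i(1) bS] by simp
  have bi: "c \<approx> b \<cdot> (i \<cdot> c)" if c: "c \<in> S" for c
  proof -
    have "i \<cdot> c \<approx> i \<cdot> (b \<cdot> (i \<cdot> c))" using ib[of "i \<cdot> c"] i c by blast
    then show ?thesis by (rule R_cancel[rotated -1]) (use i c bS in auto)
  qed
  have "(a \<cdot> i) \<cdot> c \<approx> a \<cdot> (i \<cdot> c)" if ac: "a \<in> S" "c \<in> S" for a c
  proof -
    \<comment> \<open>Writing \<open>a\<close> as \<open>b \<cdot> a'\<close> lets the factor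
      \<open>i\<close> cancel against \<open>b\<close>.\<close>
    obtain a' where a': "a' \<in> S" "b \<cdot> a' = a" using divide[OF bS ac(1)] by blast
    have "a \<cdot> i = i \<cdot> (b \<cdot> a')" using a' ac i comm by simp
    then have "(a \<cdot> i) \<cdot> c \<approx> a' \<cdot> c" using R_right[OF ac(2) R_sym[OF ib[OF a'(1)]]] by simp
    also have "\<dots> \<approx> a' \<cdot> (b \<cdot> (i \<cdot> c))" by (intro R_left bi a' ac)
    also have "\<dots> \<approx> (a' \<cdot> b) \<cdot> (i \<cdot> c)" by (intro R_sym[OF M] closed a' ac i)
    also have "(a' \<cdot> b) \<cdot> (i \<cdot> c) = a \<cdot> (i \<cdot> c)" using a' comm bS by simp
    finally show ?thesis .
  qed
  then have "i \<in> ?M" using i by simp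
  then have "i \<cdot> (b \<cdot> b') \<in> ?M" using mult b(3) by blast
  then have *: "\<And>a c. a \<in> S \<Longrightarrow> c \<in> S \<Longrightarrow> (a \<cdot> (i \<cdot> (b \<cdot> b'))) \<cdot> c \<approx> a \<cdot> ((i \<cdot> (b \<cdot> b')) \<cdot> c)" by blast
  have "(a \<cdot> b') \<cdot> c \<approx> a \<cdot> (b' \<cdot> c)" if ac: "a \<in> S" "c \<in> S" for a c
  proof -
    have "(a \<cdot> b') \<cdot> c \<approx> (a \<cdot> (i \<cdot> (b \<cdot> b'))) \<cdot> c" using R_right[OF ac(2) R_left[OF ac(1) ib[OF b(2)]]] .
    also have "\<dots> \<approx> a \<cdot> ((i \<cdot> (b \<cdot> b')) \<cdot> c)" by (intro * ac)
    also have "\<dots> \<approx> a \<cdot> (b' \<cdot> c)" using R_left[OF ac(1) R_right[OF ac(2) R_sym[OF ib[OF b(2)]]]] .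
    finally show ?thesis .
  qed
  then show "b' \<in> ?M" using b by simp
qed auto

text \<open>Being fixed by an inner mapping spreads from the generators to one entry of the associator at a time;
  the last entry is reached through the middle nucleus, which is itself a subloop.\<close>

lemma associative_if_generators:
  assumes lam: lam_hom
    and gen: "\<And>T. subloop S m e T \<Longrightarrow> x \<in> T \<Longrightarrow> y \<in> T \<Longrightarrow> S \<subseteq> T"
    and S: "x \<in> S" "y \<in> S"
    and xxy: "(x \<cdot> x) \<cdot> y \<approx> x \<cdot> (x \<cdot> y)" and xyy: "(x \<cdot> y) \<cdot> y \<approx> x \<cdot> (y \<cdot> y)"
  shows "nucleus = S"
proof -
  have 1: "(b \<cdot> a) \<cdot> c \<approx> b \<cdot> (a \<cdot> c)"
    if "a \<in> S" "b \<in> S" "c \<in> S" "(b \<cdot> a) \<cdot> x \<approx> b \<cdot> (a \<cdot> x)" "(b \<cdot> a) \<cdot> y \<approx> b \<cdot> (a \<cdot> y)" for a b c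
    using gen[OF subloop_lam_fixed[OF lam that(1,2)]] that S by blast
  have yyx: "(y \<cdot> y) \<cdot> x \<approx> y \<cdot> (y \<cdot> x)" using R_sym[OF xyy] S comm by (metis closed)
  have yxx: "(y \<cdot> x) \<cdot> x \<approx> y \<cdot> (x \<cdot> x)" using R_sym[OF xxy] S comm by (metis closed)
  have flex: "(b \<cdot> a) \<cdot> b \<approx> b \<cdot> (a \<cdot> b)" if "a \<in> S" "b \<in> S" for a b
    using that comm R_refl by (metis closed)
  have 2: "(b \<cdot> a) \<cdot> c \<approx> b \<cdot> (a \<cdot> c)" if ab: "a \<in> {x, y}" "b \<in> {x, y}" and c: "c \<in> S" for a b c
  proof (rule 1)
    show "a \<in> S" "b \<in> S" "c \<in> S" using ab c S by blast+
    show "(b \<cdot> a) \<cdot> x \<approx> b \<cdot> (a \<cdot> x)"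
      using ab flex[OF S(1) S(1)] flex[OF S(2) S(1)] yxx yyx by blast
    show "(b \<cdot> a) \<cdot> y \<approx> b \<cdot> (a \<cdot> y)"
      using ab flex[OF S(2) S(2)] flex[OF S(1) S(2)] xxy xyy by blast
  qed
  have 3: "(b \<cdot> a) \<cdot> c \<approx> b \<cdot> (a \<cdot> c)" if a: "a \<in> {x, y}" and bc: "b \<in> S" "c \<in> S" for a b c
  proof -
    have aS: "a \<in> S" using a S by blast
    have "(b \<cdot> a) \<cdot> d \<approx> b \<cdot> (a \<cdot> d)" if d: "d \<in> {x, y}" for d
    proof -
      have dS: "d \<in> S" using d S by blast
      \<comment> \<open>Commutativity exchanges the outer entries: fact \<open>2\<close> with
        \<open>b\<close> last becomes the statement with the generator \<open>d\<close> last, which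
        is what \<open>1\<close> takes as input.\<close>
      have "(d \<cdot> a) \<cdot> b \<approx> d \<cdot> (a \<cdot> b)" using 2 a d bc by blast
      moreover have "(d \<cdot> a) \<cdot> b = b \<cdot> (a \<cdot> d)" "d \<cdot> (a \<cdot> b) = (b \<cdot> a) \<cdot> d"
        using aS dS bc comm by (metis closed)+
      ultimately show ?thesis using R_sym by simp
    qed
    then show ?thesis using 1 aS bc by blast
  qed
  then have "S \<subseteq> {b \<in> S. \<forall>a\<in>S. \<forall>c\<in>S. (a \<cdot> b) \<cdot> c \<approx> a \<cdot> (b \<cdot> c)}"
    by (intro gen subloop_middle_nucleus) (use S in auto)
  then show ?thesis unfolding nucleus_def by blast
qed

end

section \<open>The associator calculus in nilpotency class three\<close>

locale cal3 = comm_loop +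
  assumes lam: lam_hom
    and nilpotent: "loop_congruence.nucleus S m R2 = S"
begin

lemma Z1_iff: "k \<in> Z1 \<longleftrightarrow> k \<in> S \<and> (\<forall>a\<in>S. \<forall>b\<in>S. (k \<cdot> a) \<cdot> b = k \<cdot> (a \<cdot> b))"
proof -
  interpret E0: loop_congruence S m e eq_on by (rule loop_congruence_eq)
  show ?thesis by (auto simp: E0.nucleus_def eq_on_def)
qed

lemma Z1_in [simp]: "k \<in> Z1 \<Longrightarrow> k \<in> S"
  by (simp add: Z1_iff)

lemma unit_Z1 [simp]: "e \<in> Z1"
  by (subst Z1_iff) simp

lemma Z1_mult [simp]: "k \<in> Z1 \<Longrightarrow> l \<in> Z1 \<Longrightarrow> k \<cdot> l \<in> Z1"
  using loop_congruence.nucleus_mult[OF loop_congruence_eq] by blast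

lemma R1_iff: "R1 a b \<longleftrightarrow> a \<in> S \<and> b \<in> S \<and> (\<exists>k\<in>Z1. b = a \<cdot> k)"
  unfolding loop_congruence.extend_def[OF loop_congruence_eq] eq_on_def by auto

lemma Z2_in [simp]: "z \<in> Z2 \<Longrightarrow> z \<in> S"
  using loop_congruence.nucleus_in[OF loop_congruence_R1] .

lemma Z1_Z2 [simp]: "k \<in> Z1 \<Longrightarrow> k \<in> Z2"
  using nucleus_mono[OF loop_congruence_eq loop_congruence_R1]
    loop_congruence.extend_mono[OF loop_congruence_eq]
    loop_congruence.central_subgroup_nucleus[OF loop_congruence_eq] by blast

lemma Z2_mult [simp]: "k \<in> Z2 \<Longrightarrow> l \<in> Z2 \<Longrightarrow> k \<cdot> l \<in> Z2"
  using loop_congruence.nucleus_mult[OF loop_congruence_R1] .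

text \<open>Multiplication by a central element gets its own symbol, so that the simplifier can move central
  factors outwards without looping when both factors are central.\<close>

definition act :: "'a \<Rightarrow> 'a \<Rightarrow> 'a" (infixl "\<odot>" 65) where "a \<odot> k = a \<cdot> k"

lemma act_in [simp]: "a \<in> S \<Longrightarrow> k \<in> Z1 \<Longrightarrow> a \<odot> k \<in> S"
  by (simp add: act_def)

lemma act_unit [simp]: "a \<in> S \<Longrightarrow> a \<odot> e = a"
  by (simp add: act_def)

lemma Z1_assoc: "k \<in> Z1 \<Longrightarrow> a \<in> S \<Longrightarrow> b \<in> S \<Longrightarrow> (k \<cdot> a) \<cdot> b = k \<cdot> (a \<cdot> b)"
  using Z1_iff by blast

lemma mult_act [simp]: "k \<in> Z1 \<Longrightarrow> a \<in> S \<Longrightarrow> b \<in> S \<Longrightarrow> a \<cdot> (b \<odot> k) = (a \<cdot> b) \<odot> k"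
  using Z1_assoc[of k b a] comm[of a "k \<cdot> b"] comm[of b k] comm[of b a] comm[of k "a \<cdot> b"]
  by (simp add: act_def)

lemma act_mult [simp]: "k \<in> Z1 \<Longrightarrow> a \<in> S \<Longrightarrow> b \<in> S \<Longrightarrow> (a \<odot> k) \<cdot> b = (a \<cdot> b) \<odot> k"
  using mult_act[of k b a] comm act_in by metis

lemma act_act [simp]: "k \<in> Z1 \<Longrightarrow> l \<in> Z1 \<Longrightarrow> a \<in> S \<Longrightarrow> (a \<odot> k) \<odot> l = a \<odot> (k \<cdot> l)"
  using mult_act[of l a k] unfolding act_def by simp

lemma act_cancel [simp]: "k \<in> Z1 \<Longrightarrow> l \<in> Z1 \<Longrightarrow> a \<in> S \<Longrightarrow> a \<odot> k = a \<odot> l \<longleftrightarrow> k = l"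
  by (simp add: act_def)

lemma act_cancel_right [simp]: "k \<in> Z1 \<Longrightarrow> a \<in> S \<Longrightarrow> b \<in> S \<Longrightarrow> a \<odot> k = b \<odot> k \<longleftrightarrow> a = b"
  by (simp add: act_def)

lemma Z1_ac:
  "k \<in> Z1 \<Longrightarrow> l \<in> Z1 \<Longrightarrow> k \<cdot> l = l \<cdot> k"
  "k \<in> Z1 \<Longrightarrow> l \<in> Z1 \<Longrightarrow> j \<in> Z1 \<Longrightarrow> (k \<cdot> l) \<cdot> j = k \<cdot> (l \<cdot> j)"
  "k \<in> Z1 \<Longrightarrow> l \<in> Z1 \<Longrightarrow> j \<in> Z1 \<Longrightarrow> k \<cdot> (l \<cdot> j) = l \<cdot> (k \<cdot> j)"
proof -
  show 1: "k \<in> Z1 \<Longrightarrow> l \<in> Z1 \<Longrightarrow> k \<cdot> l = l \<cdot> k" for k l by (simp add: comm)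
  show 2: "k \<in> Z1 \<Longrightarrow> l \<in> Z1 \<Longrightarrow> j \<in> Z1 \<Longrightarrow> (k \<cdot> l) \<cdot> j = k \<cdot> (l \<cdot> j)" for k l j by (simp add: Z1_assoc)
  show "k \<in> Z1 \<Longrightarrow> l \<in> Z1 \<Longrightarrow> j \<in> Z1 \<Longrightarrow> k \<cdot> (l \<cdot> j) = l \<cdot> (k \<cdot> j)"
    using 1[of k l] by (simp flip: 2)
qed

abbreviation "assoc \<equiv> associator S m"

lemma assoc_in_S [simp]: "a \<in> S \<Longrightarrow> b \<in> S \<Longrightarrow> c \<in> S \<Longrightarrow> assoc a b c \<in> S"
  by (rule associator)

text \<open>Class at most three makes the quotient by \<open>Z2\<close> associative. Unfolding
  \<open>R2\<close> gives the associator only up to a central factor, which \<open>Z2\<close>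
  absorbs.\<close>

lemma assoc_Z2 [simp]:
  assumes "a \<in> S" "b \<in> S" "c \<in> S"
  shows "assoc a b c \<in> Z2"
proof -
  interpret E1: loop_congruence S m e R1 by (rule loop_congruence_R1)
  interpret E2: loop_congruence S m e R2 by (rule loop_congruence_R2)
  have "R2 (a \<cdot> (b \<cdot> c)) ((a \<cdot> b) \<cdot> c)"
    using E2.nucleusD[of a b c] nilpotent assms E2.R_sym by blast
  then obtain z where z: "z \<in> Z2" "R1 ((a \<cdot> b) \<cdot> c) ((a \<cdot> (b \<cdot> c)) \<cdot> z)"
    unfolding E1.extend_def by blast
  then obtain k where k: "k \<in> Z1" "(a \<cdot> b) \<cdot> c = ((a \<cdot> (b \<cdot> c)) \<cdot> z) \<odot> k"
    using E1.R_sym[OF z(2)] unfolding R1_iff act_def by blast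
  have "assoc a b c = z \<odot> k"
    using k z assms by (intro associator_eqI) simp_all
  then show ?thesis using z k by (simp add: act_def)
qed

lemma assoc_Z1 [simp]:
  assumes "z \<in> Z2" "a \<in> S" "b \<in> S"
  shows "assoc z a b \<in> Z1"
proof -
  interpret E1: loop_congruence S m e R1 by (rule loop_congruence_R1)
  have "R1 (z \<cdot> (a \<cdot> b)) ((z \<cdot> a) \<cdot> b)"
    using E1.nucleusD E1.R_sym assms by blast
  then obtain k where "k \<in> Z1" "(z \<cdot> a) \<cdot> b = (z \<cdot> (a \<cdot> b)) \<cdot> k"
    unfolding R1_iff by blast
  then show ?thesis using associator_eqI[of z a b k] assms by simp
qed

lemma assoc_act: "z \<in> Z2 \<Longrightarrow> a \<in> S \<Longrightarrow> b \<in> S \<Longrightarrow> (z \<cdot> a) \<cdot> b = (z \<cdot> (a \<cdot> b)) \<odot> assoc z a b"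
  unfolding act_def by (intro associator) auto

text \<open>For \<^term>\<open>z \<in> Z2\<close> the inner mapping given by \<^term>\<open>a\<close>, \<^term>\<open>z\<close> moves \<^term>\<open>b\<close> by the central
  factor \<^term>\<open>assoc z a b\<close>, so its multiplicativity is the additivity of the associator.\<close>

lemma assoc_mult_right:
  assumes z: "z \<in> Z2" and S: "a \<in> S" "b \<in> S" "c \<in> S"
  shows "assoc z a (b \<cdot> c) = assoc z a b \<cdot> assoc z a c"
proof -
  have "(z \<cdot> a) \<cdot> (b \<cdot> c) = z \<cdot> (a \<cdot> ((b \<odot> assoc z a b) \<cdot> (c \<odot> assoc z a c)))"
    by (rule lam_homD[OF lam]) (use z S in \<open>simp_all add: assoc_act\<close>)
  also have "\<dots> = (z \<cdot> (a \<cdot> (b \<cdot> c))) \<odot> (assoc z a b \<cdot> assoc z a c)"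
    using z S by (simp add: Z1_ac)
  finally show ?thesis using z S by (simp add: assoc_act)
qed

text \<open>Now the inner mapping given by \<open>z\<close>, \<open>a\<close> is used. It changes
  \<open>b\<close> by a quotient of two associators; putting one on the argument and the other on
  the image avoids inverses, and additivity on the right cancels the surplus.\<close>

lemma assoc_mult_mid:
  assumes z: "z \<in> Z2" and S: "a \<in> S" "b \<in> S" "c \<in> S"
  shows "assoc z (b \<cdot> c) a = assoc z b a \<cdot> assoc z c a"
proof -
  have swap: "a \<cdot> (z \<cdot> d) = (z \<cdot> (a \<cdot> d)) \<odot> assoc z d a" if "d \<in> S" for d
  proof -
    have "a \<cdot> (z \<cdot> d) = (z \<cdot> d) \<cdot> a" "d \<cdot> a = a \<cdot> d" using z S that comm by auto
    then show ?thesis using z S that by (simp add: assoc_act)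
  qed
  have swap': "(a \<cdot> z) \<cdot> d = (z \<cdot> (a \<cdot> d)) \<odot> assoc z a d" if "d \<in> S" for d
    using z S that comm[of a z] by (simp add: assoc_act)
  have "(a \<cdot> z) \<cdot> ((b \<odot> assoc z b a) \<cdot> (c \<odot> assoc z c a)) =
      a \<cdot> (z \<cdot> ((b \<odot> assoc z a b) \<cdot> (c \<odot> assoc z a c)))"
    by (rule lam_homD[OF lam]) (use z S in \<open>simp_all add: swap swap' Z1_ac\<close>)
  then have "(z \<cdot> (a \<cdot> (b \<cdot> c))) \<odot> (assoc z a b \<cdot> assoc z a c \<cdot> (assoc z b a \<cdot> assoc z c a)) =
      (z \<cdot> (a \<cdot> (b \<cdot> c))) \<odot> (assoc z a b \<cdot> assoc z a c \<cdot> assoc z (b \<cdot> c) a)"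
    using z S by (simp add: swap swap' assoc_mult_right Z1_ac)
  then show ?thesis using z S by simp
qed

text \<open>A homomorphism into the abelian group \<open>Z1\<close> takes the same value on both
  bracketings of a product, hence kills associators.\<close>

lemma assoc_assoc_right [simp]:
  assumes z: "z \<in> Z2" and S: "a \<in> S" "b \<in> S" "c \<in> S" "d \<in> S"
  shows "assoc z a (assoc b c d) = e"
proof -
  let ?k = "assoc z a b \<cdot> (assoc z a c \<cdot> assoc z a d)"
  have "assoc z a ((b \<cdot> c) \<cdot> d) = assoc z a ((b \<cdot> (c \<cdot> d)) \<cdot> assoc b c d)"
    using associator(2)[of b c d] S by simp
  then have "?k = ?k \<cdot> assoc z a (assoc b c d)"
    using z S by (simp add: assoc_mult_right Z1_ac)
  then have "?k \<cdot> e = ?k \<cdot> assoc z a (assoc b c d)" using z S by simp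
  then show ?thesis using z S left_cancel[of ?k e "assoc z a (assoc b c d)"] by simp
qed

lemma assoc_assoc_mid [simp]:
  assumes z: "z \<in> Z2" and S: "a \<in> S" "b \<in> S" "c \<in> S" "d \<in> S"
  shows "assoc z (assoc b c d) a = e"
proof -
  let ?k = "assoc z b a \<cdot> (assoc z c a \<cdot> assoc z d a)"
  have "assoc z ((b \<cdot> c) \<cdot> d) a = assoc z ((b \<cdot> (c \<cdot> d)) \<cdot> assoc b c d) a"
    using associator(2)[of b c d] S by simp
  then have "?k = ?k \<cdot> assoc z (assoc b c d) a"
    using z S by (simp add: assoc_mult_mid Z1_ac)
  then have "?k \<cdot> e = ?k \<cdot> assoc z (assoc b c d) a" using z S by simp
  then show ?thesis using z S left_cancel[of ?k e "assoc z (assoc b c d) a"] by simp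
qed

lemma assoc_central [simp]:
  assumes "k \<in> Z1" "a \<in> S" "b \<in> S"
  shows "assoc k a b = e" "assoc a k b = e" "assoc a b k = e"
proof -
  have *: "k \<cdot> c = c \<odot> k" "c \<cdot> k = c \<odot> k" if "c \<in> S" for c
    using that assms comm[of k c] by (simp_all add: act_def)
  show "assoc k a b = e" "assoc a k b = e" "assoc a b k = e"
    using assms by (intro associator_eqI; simp add: *)+
qed

lemma Z2_mult_assoc:
  assumes "z \<in> Z2" "A \<in> S" "b \<in> S" "c \<in> S" "d \<in> S"
  shows "z \<cdot> (A \<cdot> assoc b c d) = (z \<cdot> A) \<cdot> assoc b c d"
  using assoc_act[of z A "assoc b c d"] assms by simp

text \<open>Used as rewrite rules to bring \<open>z\<close> to the front at the cost of a central
  factor.\<close>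

lemma mult_Z2:
  assumes "z \<in> Z2" "a \<in> S" "b \<in> S"
  shows "a \<cdot> (z \<cdot> b) = (z \<cdot> (b \<cdot> a)) \<odot> assoc z b a"
    "(a \<cdot> z) \<cdot> b = (z \<cdot> (a \<cdot> b)) \<odot> assoc z a b"
    "a \<cdot> (b \<cdot> z) = (z \<cdot> (b \<cdot> a)) \<odot> assoc z b a"
  using assms comm[of a "z \<cdot> b"] comm[of a z] comm[of b z] by (simp_all add: assoc_act)

text \<open>Commutativity reverses a product of three factors while exchanging its bracketings, so
  the two associators undo each other; they may be rebracketed because an associator in the second
  or third place of \<open>assoc_act\<close> contributes \<open>e\<close>.\<close>

lemma assoc_comm_swap:
  assumes "a \<in> S" "b \<in> S" "c \<in> S"
  shows "assoc a b c \<cdot> assoc c b a = e"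
proof -
  let ?M = "(a \<cdot> b) \<cdot> c" and ?q = "assoc a b c" and ?q' = "assoc c b a"
  have M: "?M \<in> S" using assms by blast
  have eq: "(c \<cdot> b) \<cdot> a = a \<cdot> (b \<cdot> c)" "c \<cdot> (b \<cdot> a) = ?M" using assms comm by auto
  have "?M = (?M \<cdot> ?q') \<cdot> ?q"
    using associator(2)[OF assms] associator(2)[OF assms(3,2,1)] unfolding eq by argo
  also have "?M \<cdot> ?q' = ?q' \<cdot> ?M" using assms by (intro comm) auto
  also have "(?q' \<cdot> ?M) \<cdot> ?q = ?q' \<cdot> (?M \<cdot> ?q)"
    using assms M assoc_act[of ?q' ?M ?q] by simp
  also have "?M \<cdot> ?q = ?q \<cdot> ?M" using assms by (intro comm) auto
  also have "?q' \<cdot> (?q \<cdot> ?M) = (?q' \<cdot> ?q) \<cdot> ?M" using assms M assoc_act[of ?q' ?q ?M] by simp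
  finally have "e \<cdot> ?M = (?q' \<cdot> ?q) \<cdot> ?M" using M by simp
  then show ?thesis using assms M comm[of ?q ?q'] right_cancel[of ?M e "?q' \<cdot> ?q"] by simp
qed

text \<open>This and the next two lemmas describe how a factor from \<open>Z2\<close> in one
  argument changes an associator. Corrections that would be inverses stand on the other side of the
  equation.\<close>

lemma assoc_left_Z2:
  assumes z: "z \<in> Z2" and S: "a \<in> S" "b \<in> S" "c \<in> S"
  shows "assoc (a \<cdot> z) b c = assoc a b c \<odot> assoc z b c"
proof -
  let ?M = "a \<cdot> (b \<cdot> c)"
  have M: "?M \<in> S" using S by blast
  have "((a \<cdot> z) \<cdot> b) \<cdot> c = (z \<cdot> (?M \<cdot> assoc a b c)) \<odot> (assoc z (a \<cdot> b) c \<cdot> assoc z a b)"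
    using z S associator(2)[of a b c] by (simp add: mult_Z2[OF z] assoc_act[OF z])
  also have "z \<cdot> (?M \<cdot> assoc a b c) = (z \<cdot> ?M) \<cdot> assoc a b c"
    using z S by (simp add: Z2_mult_assoc[OF z])
  finally show ?thesis
    using z S by (intro associator_eqI) (simp_all add: mult_Z2[OF z] assoc_mult_right assoc_mult_mid Z1_ac)
qed

lemma assoc_mid_Z2:
  assumes z: "z \<in> Z2" and S: "a \<in> S" "b \<in> S" "c \<in> S"
  shows "assoc a (b \<cdot> z) c \<odot> assoc z c a = assoc a b c \<odot> assoc z a c"
proof -
  let ?M = "a \<cdot> (b \<cdot> c)" and ?w = "assoc a (b \<cdot> z) c"
  have M: "?M \<in> S" "?w \<in> S" using S z by auto
  let ?k = "assoc z b a \<cdot> assoc z b c"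
  have l: "(a \<cdot> (b \<cdot> z)) \<cdot> c = (z \<cdot> (?M \<cdot> assoc a b c)) \<odot> (assoc z (a \<cdot> b) c \<cdot> assoc z b a)"
    using z S associator(2)[of a b c] comm[of b a] by (simp add: mult_Z2[OF z] assoc_act[OF z])
  have r: "a \<cdot> ((b \<cdot> z) \<cdot> c) = (z \<cdot> ?M) \<odot> (assoc z (b \<cdot> c) a \<cdot> assoc z b c)"
    using z S comm[of "b \<cdot> c" a] by (simp add: mult_Z2[OF z] assoc_act[OF z])
  have "(z \<cdot> ?M) \<cdot> (?w \<odot> assoc z c a) \<odot> ?k = (a \<cdot> ((b \<cdot> z) \<cdot> c)) \<cdot> ?w"
    unfolding r using z S M by (simp add: assoc_mult_mid assoc_mult_right Z1_ac)
  also have "\<dots> = (a \<cdot> (b \<cdot> z)) \<cdot> c"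
    using associator(2)[of a "b \<cdot> z" c] z S by simp
  also have "\<dots> = (z \<cdot> ?M) \<cdot> (assoc a b c \<odot> assoc z a c) \<odot> ?k"
    unfolding l Z2_mult_assoc[OF z M(1) S] using z S M by (simp add: assoc_mult_mid assoc_mult_right Z1_ac)
  finally show ?thesis
    \<comment> \<open>The rules that move central factors outwards are switched off so that
      \<open>?k\<close> and \<open>z \<cdot> ?M\<close> can be cancelled.\<close>
    using z S M by (simp del: mult_act act_act)
qed

lemma assoc_right_Z2:
  assumes z: "z \<in> Z2" and S: "a \<in> S" "b \<in> S" "c \<in> S"
  shows "assoc a b (c \<cdot> z) \<odot> assoc z b a = assoc a b c"
proof -
  let ?M = "a \<cdot> (b \<cdot> c)" and ?w = "assoc a b (c \<cdot> z)"
  have M: "?M \<in> S" "?w \<in> S" using S z by auto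
  let ?k = "assoc z c a \<cdot> assoc z c b"
  have l: "(a \<cdot> b) \<cdot> (c \<cdot> z) = (z \<cdot> (?M \<cdot> assoc a b c)) \<odot> assoc z c (a \<cdot> b)"
    using z S associator(2)[of a b c] comm[of c "a \<cdot> b"] by (simp add: mult_Z2[OF z] assoc_act[OF z])
  have r: "a \<cdot> (b \<cdot> (c \<cdot> z)) = (z \<cdot> ?M) \<odot> (assoc z (c \<cdot> b) a \<cdot> assoc z c b)"
    using z S comm[of "c \<cdot> b" a] comm[of c b] by (simp add: mult_Z2[OF z] assoc_act[OF z])
  have "(z \<cdot> ?M) \<cdot> (?w \<odot> assoc z b a) \<odot> ?k = (a \<cdot> (b \<cdot> (c \<cdot> z))) \<cdot> ?w"
    unfolding r using z S M by (simp add: assoc_mult_mid assoc_mult_right Z1_ac)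
  also have "\<dots> = (a \<cdot> b) \<cdot> (c \<cdot> z)"
    using associator(2)[of a b "c \<cdot> z"] z S by simp
  also have "\<dots> = (z \<cdot> ?M) \<cdot> assoc a b c \<odot> ?k"
    unfolding l Z2_mult_assoc[OF z M(1) S] using z S M by (simp add: assoc_mult_mid assoc_mult_right Z1_ac)
  finally show ?thesis
    using z S M by (simp del: mult_act act_act)
qed

lemma assoc_mult_left:
  assumes "z \<in> Z2" "z' \<in> Z2" "a \<in> S" "b \<in> S"
  shows "assoc (z \<cdot> z') a b = assoc z a b \<cdot> assoc z' a b"
  using assoc_left_Z2[of z' z a b] assms by (simp add: act_def)

lemma assoc_act_left [simp]:
  assumes "k \<in> Z1" "a \<in> S" "b \<in> S" "c \<in> S"
  shows "assoc (a \<odot> k) b c = assoc a b c" "assoc a (b \<odot> k) c = assoc a b c" "assoc a b (c \<odot> k) = assoc a b c"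
  using assoc_left_Z2[of k a b c] assoc_mid_Z2[of k a b c] assoc_right_Z2[of k a b c] assms
  by (simp_all add: act_def[of a k] act_def[of b k] act_def[of c k])

lemma assoc_reverse:
  assumes "z \<in> Z2" "a \<in> S" "b \<in> S"
  shows "assoc a b z \<cdot> assoc z b a = e"
  using assoc_comm_swap[of a b z] assms by simp

text \<open>Both relations below come from applying an inner automorphism to the identity that defines an
  associator: the one given by \<^term>\<open>x\<close>, \<^term>\<open>y\<close> to \<^term>\<open>assoc x x y\<close>, and the one given by
  \<^term>\<open>x\<close>, \<^term>\<open>x\<close> to \<^term>\<open>assoc x y y\<close>.\<close>

lemma assoc_symmetric:
  assumes S: "x \<in> S" "y \<in> S"
  defines "u \<equiv> assoc x x y"
  shows "assoc u x y = assoc u y x"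
proof -
  have u: "u \<in> Z2" "u \<in> S" using S by (simp_all add: u_def)
  have kill: "assoc u u y = e" "assoc u x u = e" "assoc u y u = e" "assoc u u x = e"
    using S u by (simp_all add: u_def)
  obtain f where f: "automorphism S m f" "\<And>c. c \<in> S \<Longrightarrow> (y \<cdot> x) \<cdot> f c = y \<cdot> (x \<cdot> c)"
    using lam_automorphism[OF lam S] by blast
  note fS = automorphismD(2)[OF f(1)]
  have eqI: "f c = d" if "c \<in> S" "d \<in> S" "(y \<cdot> x) \<cdot> d = y \<cdot> (x \<cdot> c)" for c d
    using f(2)[OF that(1)] that S fS left_cancel[of "y \<cdot> x" "f c" d] by simp
  have fy: "f y = y" using S comm[of "y \<cdot> x" y] comm[of x y] by (intro eqI) simp_all
  let ?k = "assoc u x (y \<cdot> x)"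
  \<comment> \<open>Up to a central factor \<open>f\<close> multiplies \<open>x\<close> by
    \<open>u\<close>; that factor does not affect associators.\<close>
  have fx: "f x \<odot> ?k = x \<cdot> u"
  proof -
    have "(y \<cdot> x) \<cdot> (f x \<odot> ?k) = (y \<cdot> (x \<cdot> x)) \<odot> ?k" using f(2) fS S u by simp
    also have "y \<cdot> (x \<cdot> x) = u \<cdot> (x \<cdot> (y \<cdot> x))"
      using associator(2)[of x x y] comm[of "x \<cdot> x" y] comm[of x y] comm[of u "x \<cdot> (y \<cdot> x)"] S
      by (simp add: u_def)
    also have "\<dots> \<odot> ?k = (y \<cdot> x) \<cdot> (x \<cdot> u)" using u S by (simp add: mult_Z2[OF u(1)])
    finally show ?thesis using left_cancel[of "y \<cdot> x" "f x \<odot> ?k" "x \<cdot> u"] S fS u by simp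
  qed
  have fu: "f u = u \<odot> assoc u x y"
  proof (rule eqI)
    have "(y \<cdot> x) \<cdot> u = u \<cdot> (x \<cdot> y)" using S u comm by simp
    then show "(y \<cdot> x) \<cdot> (u \<odot> assoc u x y) = y \<cdot> (x \<cdot> u)"
      using S u comm[of x u] by (simp add: mult_Z2[OF u(1)])
  qed (use S u in auto)
  have "u \<odot> assoc u x y = assoc (f x) (f x) (f y)"
    using automorphism_associator[OF f(1) S(1) S(1) S(2)] fu by (simp add: u_def)
  also have "\<dots> = assoc (f x \<odot> ?k) (f x \<odot> ?k) y" using S u fS fy by simp
  also have "\<dots> = assoc x (x \<cdot> u) y \<odot> assoc u (x \<cdot> u) y"
    unfolding fx using S u by (simp add: assoc_left_Z2)
  also have "assoc u (x \<cdot> u) y = assoc u x y" using S u kill by (simp add: assoc_mult_mid)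
  \<comment> \<open>The factor \<open>assoc u x y\<close> from \<open>f u\<close> cancels the one
    produced by \<open>u\<close> in the first argument; expanding the second argument then compares
    the two sides of the claim.\<close>
  finally have w: "assoc x (x \<cdot> u) y = u" using S u by simp
  show ?thesis
    using assoc_mid_Z2[of u x x y] S u unfolding w by (simp flip: u_def)
qed

lemma assoc_left_eq:
  assumes S: "x \<in> S" "y \<in> S"
  defines "u \<equiv> assoc x x y" and "v \<equiv> assoc x y y"
  shows "assoc u x y = assoc v x x"
proof -
  have u: "u \<in> Z2" "u \<in> S" using S by (simp_all add: u_def)
  have v: "v \<in> Z2" "v \<in> S" using S by (simp_all add: v_def)
  have kill: "assoc u u x = e" "assoc u x u = e" using S u by (simp_all add: u_def)
  obtain f where f: "automorphism S m f" "\<And>c. c \<in> S \<Longrightarrow> (x \<cdot> x) \<cdot> f c = x \<cdot> (x \<cdot> c)"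
    using lam_automorphism[OF lam S(1) S(1)] by blast
  note fS = automorphismD(2)[OF f(1)]
  have eqI: "f c = d" if "c \<in> S" "d \<in> S" "(x \<cdot> x) \<cdot> d = x \<cdot> (x \<cdot> c)" for c d
    using f(2)[OF that(1)] that S fS left_cancel[of "x \<cdot> x" "f c" d] by simp
  have fx: "f x = x" using S comm[of "x \<cdot> x" x] by (intro eqI) simp_all
  let ?y = "f y"
  have yS: "?y \<in> S" using fS S by blast
  let ?k = "assoc u ?y (x \<cdot> x)"
  \<comment> \<open>Thus \<open>f\<close> divides \<open>y\<close> by \<open>u\<close> up to a
    central factor.\<close>
  have fy: "?y \<cdot> u = y \<odot> ?k"
  proof -
    have "(x \<cdot> x) \<cdot> (?y \<cdot> u) = (u \<cdot> ((x \<cdot> x) \<cdot> ?y)) \<odot> ?k"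
      using u S yS comm[of "x \<cdot> x" ?y] by (simp add: mult_Z2[OF u(1)])
    also have "u \<cdot> ((x \<cdot> x) \<cdot> ?y) = (x \<cdot> x) \<cdot> y"
      using f(2)[OF S(2)] associator(2)[of x x y] comm[of u "x \<cdot> (x \<cdot> y)"] S u by (simp add: u_def)
    also have "\<dots> \<odot> ?k = (x \<cdot> x) \<cdot> (y \<odot> ?k)" using S u yS by simp
    finally show ?thesis using left_cancel[of "x \<cdot> x" "?y \<cdot> u" "y \<odot> ?k"] S yS u by simp
  qed
  have fv: "f v = v \<odot> assoc v x x"
    by (intro eqI) (use S v in \<open>simp_all add: mult_Z2[OF v(1)] comm[of "x \<cdot> x" v] comm[of x v]\<close>)
  \<comment> \<open>Since \<open>u\<close> and central factors contribute nothing to these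
    associators, \<open>f y\<close> may be replaced by \<open>y\<close> in them.\<close>
  have "assoc u (y \<odot> ?k) x = assoc u ?y x" unfolding fy[symmetric]
    using u S yS kill by (simp add: assoc_mult_mid)
  then have ky: "assoc u ?y x = assoc u y x" using u S yS by simp
  have "assoc u x (y \<odot> ?k) = assoc u x ?y" unfolding fy[symmetric]
    using u S yS kill by (simp add: assoc_mult_right)
  then have kx: "assoc u x ?y = assoc u x y" using u S yS by simp
  let ?B = "assoc u x y"
  have sym: "assoc u y x = ?B" using assoc_symmetric[OF S] by (simp add: u_def)
  \<comment> \<open>Both occurrences of \<open>y\<close> in \<open>v\<close> are replaced through
    \<open>fy\<close>. Removing \<open>u\<close> from the last argument costs \<open>?B\<close>;
    removing it from the middle one costs nothing because the two corrections agree by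
    \<open>sym\<close>.\<close>
  have "v = assoc x (?y \<cdot> u) (?y \<cdot> u)" unfolding fy v_def using S u yS by simp
  moreover have "assoc x (?y \<cdot> u) (?y \<cdot> u) \<odot> assoc u (?y \<cdot> u) x = assoc x (?y \<cdot> u) ?y"
    using assoc_right_Z2[of u x "?y \<cdot> u" ?y] S u yS by simp
  ultimately have "v \<odot> ?B = assoc x (?y \<cdot> u) ?y"
    using u S yS ky kill sym by (simp add: assoc_mult_mid)
  moreover have "assoc x (?y \<cdot> u) ?y \<odot> ?B = assoc x ?y ?y \<odot> ?B"
    using assoc_mid_Z2[of u x ?y ?y] S u yS kx ky sym by simp
  ultimately have "v \<odot> ?B = assoc x ?y ?y" using S u v yS by simp
  also have "\<dots> = f v" using automorphism_associator[OF f(1) S(1) S(2) S(2)] fx by (simp add: v_def)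
  finally show ?thesis using fv S u v by simp
qed

end

section \<open>The normal form\<close>

text \<open>A homomorphism from the integers determines all powers of its value at 1; it is applied
  to the coordinate axes of \<open>Z8\<close>.\<close>

lemma (in comm_loop) ipow_eqI:
  assumes f: "\<And>i. f i \<in> S" "f 0 = e" "\<And>i j. f (i + j) = f i \<cdot> f j"
  shows "ipow S m e (f 1) n = f n"
proof -
  have npow: "npow m e (f 1) k = f (int k)" for k
    by (induction k) (simp_all add: f flip: f(3))
  have linv_f: "linv S m e (f (int k)) = f (- int k)" for k
  proof -
    have "f (int k) \<cdot> linv S m e (f (int k)) = f (int k) \<cdot> f (- int k)"
      using linv(2)[OF f(1)] f(2) by (simp flip: f(3))
    then show ?thesis using left_cancel f(1) linv(1) by blast
  qed
  show ?thesis using linv_f[of "nat (- n)"] by (cases "0 \<le> n") (simp_all add: ipow_def npow)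
qed

lemma Z8_ipow:
  "ipow Z8 star zero8 [1,0,0,0,0,0,0,0] n = [n,0,0,0,0,0,0,0]"
  "ipow Z8 star zero8 [0,1,0,0,0,0,0,0] n = [0,n,0,0,0,0,0,0]"
  "ipow Z8 star zero8 [0,0,1,0,0,0,0,0] n = [0,0,n,0,0,0,0,0]"
  "ipow Z8 star zero8 [0,0,0,1,0,0,0,0] n = [0,0,0,n,0,0,0,0]"
  "ipow Z8 star zero8 [0,0,0,0,1,0,0,0] n = [0,0,0,0,n,0,0,0]"
  "ipow Z8 star zero8 [0,0,0,0,0,1,0,0] n = [0,0,0,0,0,n,0,0]"
  "ipow Z8 star zero8 [0,0,0,0,0,0,1,0] n = [0,0,0,0,0,0,n,0]"
  "ipow Z8 star zero8 [0,0,0,0,0,0,0,1] n = [0,0,0,0,0,0,0,n]"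
  using Z8.ipow_eqI[of "\<lambda>i. [i,0,0,0,0,0,0,0]" n] Z8.ipow_eqI[of "\<lambda>i. [0,i,0,0,0,0,0,0]" n]
    Z8.ipow_eqI[of "\<lambda>i. [0,0,i,0,0,0,0,0]" n] Z8.ipow_eqI[of "\<lambda>i. [0,0,0,i,0,0,0,0]" n]
    Z8.ipow_eqI[of "\<lambda>i. [0,0,0,0,i,0,0,0]" n] Z8.ipow_eqI[of "\<lambda>i. [0,0,0,0,0,i,0,0]" n]
    Z8.ipow_eqI[of "\<lambda>i. [0,0,0,0,0,0,i,0]" n] Z8.ipow_eqI[of "\<lambda>i. [0,0,0,0,0,0,0,i]" n]
  by (simp_all add: star_Cons zero8_def)

text \<open>The candidates for the eight generators are the unit vectors, in the order of the
  exponents of the normal form.\<close>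

lemma Z8_associators:
  "associator Z8 star [1,0,0,0,0,0,0,0] [1,0,0,0,0,0,0,0] [0,1,0,0,0,0,0,0] = [0,0,1,0,0,0,0,0]"
  "associator Z8 star [1,0,0,0,0,0,0,0] [0,1,0,0,0,0,0,0] [0,1,0,0,0,0,0,0] = [0,0,0,1,0,0,0,0]"
  "associator Z8 star [1,0,0,0,0,0,0,0] [1,0,0,0,0,0,0,0] [0,0,1,0,0,0,0,0] = [0,0,0,0,1,0,0,0]"
  "associator Z8 star [1,0,0,0,0,0,0,0] [1,0,0,0,0,0,0,0] [0,0,0,1,0,0,0,0] = [0,0,0,0,0,1,0,0]"
  "associator Z8 star [0,1,0,0,0,0,0,0] [0,1,0,0,0,0,0,0] [0,0,1,0,0,0,0,0] = [0,0,0,0,0,0,1,0]"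
  "associator Z8 star [0,1,0,0,0,0,0,0] [0,1,0,0,0,0,0,0] [0,0,0,1,0,0,0,0] = [0,0,0,0,0,0,0,1]"
  by (rule Z8.associator_eqI; simp add: star_Cons)+

section \<open>Homomorphisms of commutative loops\<close>

locale comm_loop_hom = S: comm_loop S m e + T: comm_loop T n u
  for S :: "'a set" and m e and T :: "'b set" and n u +
  fixes h assumes hom: "loop_hom S m T n h"
begin

lemma hom_in [simp]: "a \<in> S \<Longrightarrow> h a \<in> T" and hom_mult [simp]: "a \<in> S \<Longrightarrow> b \<in> S \<Longrightarrow> h (m a b) = n (h a) (h b)"
  using hom by (auto simp: loop_hom_def)

lemma hom_unit [simp]: "h e = u"
proof -
  have "n (h e) (h e) = n (h e) u" by (simp flip: hom_mult)
  then show ?thesis using T.left_cancel[of "h e" "h e" u] by simp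
qed

lemma hom_associator:
  assumes "a \<in> S" "b \<in> S" "c \<in> S"
  shows "h (associator S m a b c) = associator T n (h a) (h b) (h c)"
proof -
  have "n (n (h a) (h b)) (h c) = h (m (m a (m b c)) (associator S m a b c))"
    unfolding S.associator(2)[OF assms, symmetric] using assms by simp
  then show ?thesis
    using assms S.associator(1)[OF assms] by (intro T.associator_eqI[symmetric]) simp_all
qed

lemma hom_ipow:
  assumes "a \<in> S"
  shows "h (ipow S m e a k) = ipow T n u (h a) k"
proof -
  have npow: "h (npow m e a j) = npow n u (h a) j" for j
    by (induction j) (use assms in auto)
  have "h (linv S m e b) = linv T n u (h b)" if "b \<in> S" for b
  proof -
    have "n (h b) (h (linv S m e b)) = h (m b (linv S m e b))"
      using S.linv(1) that hom_mult by metis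
    also have "\<dots> = n (h b) (linv T n u (h b))"
      using S.linv(2)[OF that] T.linv(2)[OF hom_in[OF that]] by simp
    finally show ?thesis using S.linv(1) T.linv(1) that T.left_cancel by simp
  qed
  then show ?thesis using assms by (simp add: ipow_def npow)
qed

end

text \<open>The elements \<open>v1\<close> to \<open>v4\<close> have their entry from
  \<open>Z2\<close> in the last place; such an associator is the inverse of a central one.\<close>

lemma (in cal3) assoc_right_Z1:
  assumes "z \<in> Z2" "a \<in> S" "b \<in> S"
  shows "assoc a b z \<in> Z1"
proof -
  have "assoc z b a \<cdot> assoc a b z = e"
    using assoc_comm_swap[of z b a] assms by simp
  then show ?thesis
    using loop_congruence.nucleus_inverse[OF loop_congruence_eq, of "assoc z b a" "assoc a b z"] assms
    by (simp add: eq_on_def)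
qed

locale cal3_generated = cal3 +
  fixes x y
  assumes x [simp]: "x \<in> S" and y [simp]: "y \<in> S"
    and generated: "subloop S m e T \<Longrightarrow> x \<in> T \<Longrightarrow> y \<in> T \<Longrightarrow> S \<subseteq> T"
begin

text \<open>By additivity in both arguments, \<open>assoc z\<close> is trivial modulo
  \<open>R\<close> as soon as it is trivial on the four pairs of generators.\<close>

lemma Z2_nucleus:
  assumes "loop_congruence S m e R" and z: "z \<in> Z2"
    and gen: "R (assoc z x x) e" "R (assoc z x y) e" "R (assoc z y x) e" "R (assoc z y y) e"
  shows "z \<in> loop_congruence.nucleus S m R"
proof -
  interpret loop_congruence S m e R by (rule assms(1))
  \<comment> \<open>The elements on which a homomorphism into \<open>Z1\<close> is trivial modulo
    \<open>R\<close> form a subloop.\<close>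
  have hom: "R (t c) e" if c: "c \<in> S" and "R (t x) e" "R (t y) e" and t: "\<And>c. c \<in> S \<Longrightarrow> t c \<in> Z1"
    and mult: "\<And>c d. c \<in> S \<Longrightarrow> d \<in> S \<Longrightarrow> t (c \<cdot> d) = t c \<cdot> t d" for t c
  proof -
    have "subloop S m e {c \<in> S. R (t c) e}"
    proof (rule subloopI)
      have "t e \<cdot> t e = t e \<cdot> e" using mult[of e e] t by simp
      then have "t e = e" using left_cancel[of "t e" "t e" e] t by simp
      then show "e \<in> {c \<in> S. R (t c) e}" by simp
      show "c \<cdot> d \<in> {c \<in> S. R (t c) e}" if "c \<in> {c \<in> S. R (t c) e}" "d \<in> {c \<in> S. R (t c) e}" for c d
        using that R_mult[of "t c" e "t d" e] mult by simp
      show "d \<in> {c \<in> S. R (t c) e}"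
        if "c \<in> {c \<in> S. R (t c) e}" "d \<in> S" "c \<cdot> d \<in> {c \<in> S. R (t c) e}" for c d
        using that R_cancel_mult[of "t c" "t d" e e] t mult by simp
    qed auto
    from generated[OF this] that show ?thesis by auto
  qed
  have "R (assoc z c x) e" "R (assoc z c y) e" if "c \<in> S" for c
    using hom[OF that, of "\<lambda>c. assoc z c x"] hom[OF that, of "\<lambda>c. assoc z c y"] gen z
    by (simp_all add: assoc_mult_mid)
  then have *: "R (assoc z c d) e" if "c \<in> S" "d \<in> S" for c d
    using hom[OF that(2), of "\<lambda>d. assoc z c d"] that z by (simp add: assoc_mult_right)
  have "R ((z \<cdot> c) \<cdot> d) (z \<cdot> (c \<cdot> d))" if "c \<in> S" "d \<in> S" for c d
    using R_left[OF _ *[OF that], of "z \<cdot> (c \<cdot> d)"] associator(2)[of z c d] z that by simp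
  then show ?thesis using z by (simp add: nucleus_def)
qed

lemma normal_form:
  assumes s: "s \<in> S"
  defines "u1 \<equiv> assoc x x y" and "u2 \<equiv> assoc x y y"
  defines "v1 \<equiv> assoc x x u1" and "v2 \<equiv> assoc x x u2"
    and "v3 \<equiv> assoc y y u1" and "v4 \<equiv> assoc y y u2"
  shows "\<exists>n1 n2 n3 n4 n5 n6 n7 n8. s =
    (((((ipow S m e x n1 \<cdot> ipow S m e y n2) \<cdot> (ipow S m e u1 n3 \<cdot> ipow S m e u2 n4)) \<cdot> ipow S m e v1 n5)
      \<cdot> ipow S m e v2 n6) \<cdot> ipow S m e v3 n7) \<cdot> ipow S m e v4 n8"
proof -
  have u: "u1 \<in> Z2" "u2 \<in> Z2" by (simp_all add: u1_def u2_def)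
  have v: "v1 \<in> Z1" "v2 \<in> Z1" "v3 \<in> Z1" "v4 \<in> Z1"
    using u by (simp_all add: v1_def v2_def v3_def v4_def assoc_right_Z1)
  \<comment> \<open>The last factor of the normal form is adjoined first, since unwinding the chain
    recovers the exponents in the opposite order.\<close>
  obtain V1 where V1: "loop_congruence S m e V1" "\<And>a b. eq_on a b \<Longrightarrow> V1 a b" "V1 e v4"
    "\<And>a b. V1 a b \<Longrightarrow> \<exists>n. eq_on b (a \<cdot> ipow S m e v4 n)"
    using extend_by_power[OF loop_congruence_eq v(4)] by blast
  have "v3 \<in> loop_congruence.nucleus S m V1"
    using nucleus_mono[OF loop_congruence_eq V1(1,2)] v by blast
  then obtain V2 where V2: "loop_congruence S m e V2" "\<And>a b. V1 a b \<Longrightarrow> V2 a b" "V2 e v3"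
    "\<And>a b. V2 a b \<Longrightarrow> \<exists>n. V1 b (a \<cdot> ipow S m e v3 n)"
    using extend_by_power[OF V1(1)] by blast
  have "v2 \<in> loop_congruence.nucleus S m V2"
    using nucleus_mono[OF loop_congruence_eq V2(1) V2(2)[OF V1(2)]] v by blast
  then obtain V3 where V3: "loop_congruence S m e V3" "\<And>a b. V2 a b \<Longrightarrow> V3 a b" "V3 e v2"
    "\<And>a b. V3 a b \<Longrightarrow> \<exists>n. V2 b (a \<cdot> ipow S m e v2 n)"
    using extend_by_power[OF V2(1)] by blast
  have "v1 \<in> loop_congruence.nucleus S m V3"
    using nucleus_mono[OF loop_congruence_eq V3(1) V3(2)[OF V2(2)[OF V1(2)]]] v by blast
  then obtain V4 where V4: "loop_congruence S m e V4" "\<And>a b. V3 a b \<Longrightarrow> V4 a b" "V4 e v1"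
    "\<And>a b. V4 a b \<Longrightarrow> \<exists>n. V3 b (a \<cdot> ipow S m e v1 n)"
    using extend_by_power[OF V3(1)] by blast
  interpret V4: loop_congruence S m e V4 by (rule V4(1))
  \<comment> \<open>Inverses of trivial elements are trivial; this passes from the \<open>v\<close>s
    to the associators with \<open>u1\<close> or \<open>u2\<close> in front.\<close>
  have triv: "V4 t e" if "V4 e w" "w \<cdot> t = e" "w \<in> S" "t \<in> S" for w t
    using V4.R_right[OF that(4,1)] that by simp
  have V4v: "V4 e v1" "V4 e v2" "V4 e v3" "V4 e v4"
    using V4 V3 V2 V1 by blast+
  have 11: "V4 (assoc u1 x x) e"
    using triv[OF V4v(1)] assoc_reverse[of u1 x x] u v by (simp add: v1_def)
  have 12: "V4 (assoc u1 y y) e"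
    using triv[OF V4v(3)] assoc_reverse[of u1 y y] u v by (simp add: v3_def)
  have 21: "V4 (assoc u2 x x) e"
    using triv[OF V4v(2)] assoc_reverse[of u2 x x] u v by (simp add: v2_def)
  have 22: "V4 (assoc u2 y y) e"
    using triv[OF V4v(4)] assoc_reverse[of u2 y y] u v by (simp add: v4_def)
  have 13: "V4 (assoc u1 x y) e" "V4 (assoc u1 y x) e"
    using 21 assoc_left_eq[OF x y] assoc_symmetric[OF x y] by (simp_all add: u1_def u2_def)
  \<comment> \<open>Exchanging \<open>x\<close> and \<open>y\<close> in \<open>u1\<close> and
    \<open>u2\<close> gives \<open>?w1\<close>, the inverse of \<open>u2\<close>, and
    \<open>?w2\<close>, the inverse of \<open>u1\<close>. The relations for \<open>u1\<close> thus
    yield those for \<open>u2\<close>.\<close>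
  let ?w1 = "assoc y y x" and ?w2 = "assoc y x x"
  have w: "assoc ?w1 a b \<cdot> assoc u2 a b = e" "assoc u1 a b \<cdot> assoc ?w2 a b = e"
    if "a \<in> S" "b \<in> S" for a b
  proof -
    have "?w1 \<cdot> u2 = e" "u1 \<cdot> ?w2 = e"
      by (simp_all add: u1_def u2_def assoc_comm_swap)
    then show "assoc ?w1 a b \<cdot> assoc u2 a b = e" "assoc u1 a b \<cdot> assoc ?w2 a b = e"
      using assoc_mult_left[of ?w1 u2 a b] assoc_mult_left[of u1 ?w2 a b] u that by simp_all
  qed
  have "V4 (assoc ?w2 y y) e"
    using triv[OF V4.R_sym[OF 12] w(2)] u by simp
  then have "V4 e (assoc ?w1 y x)" "V4 e (assoc ?w1 x y)"
    using assoc_left_eq[OF y x] assoc_symmetric[OF y x] V4.R_sym by simp_all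
  then have 23: "V4 (assoc u2 y x) e" "V4 (assoc u2 x y) e"
    using triv w(1) u by simp_all
  have u1V4: "u1 \<in> V4.nucleus" and u2V4: "u2 \<in> V4.nucleus"
    using Z2_nucleus[OF V4(1)] u 11 12 13 21 22 23 by simp_all
  obtain V5 where V5: "loop_congruence S m e V5" "\<And>a b. V4 a b \<Longrightarrow> V5 a b" "V5 e u2"
    "\<And>a b. V5 a b \<Longrightarrow> \<exists>n. V4 b (a \<cdot> ipow S m e u2 n)"
    using extend_by_power[OF V4(1) u2V4] by blast
  have "u1 \<in> loop_congruence.nucleus S m V5"
    using nucleus_mono[OF V4(1) V5(1,2)] u1V4 by blast
  then obtain V6 where V6: "loop_congruence S m e V6" "\<And>a b. V5 a b \<Longrightarrow> V6 a b" "V6 e u1"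
    "\<And>a b. V6 a b \<Longrightarrow> \<exists>n. V5 b (a \<cdot> ipow S m e u1 n)"
    using extend_by_power[OF V5(1)] by blast
  interpret V6: loop_congruence S m e V6 by (rule V6(1))
  have "V6 e u2" using V5 V6 by blast
  then have "V6 ((x \<cdot> (x \<cdot> y)) \<cdot> e) ((x \<cdot> (x \<cdot> y)) \<cdot> u1)" "V6 ((x \<cdot> (y \<cdot> y)) \<cdot> e) ((x \<cdot> (y \<cdot> y)) \<cdot> u2)"
    using V6(3) by (blast intro: V6.R_left closed x y)+
  then have "V6 ((x \<cdot> x) \<cdot> y) (x \<cdot> (x \<cdot> y))" "V6 ((x \<cdot> y) \<cdot> y) (x \<cdot> (y \<cdot> y))"
    using associator(2)[of x x y] associator(2)[of x y y] V6.R_sym by (simp_all add: u1_def u2_def)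
  then have V6_nucleus: "V6.nucleus = S"
    using V6.associative_if_generators[OF lam generated x y] by blast
  obtain V7 where V7: "loop_congruence S m e V7" "\<And>a b. V6 a b \<Longrightarrow> V7 a b" "V7 e y"
    "\<And>a b. V7 a b \<Longrightarrow> \<exists>n. V6 b (a \<cdot> ipow S m e y n)"
    using extend_by_power[OF V6(1)] V6_nucleus y by blast
  have "x \<in> loop_congruence.nucleus S m V7"
    using nucleus_mono[OF V6(1) V7(1,2)] V6_nucleus x by blast
  then obtain V8 where V8: "loop_congruence S m e V8" "\<And>a b. V7 a b \<Longrightarrow> V8 a b" "V8 e x"
    "\<And>a b. V8 a b \<Longrightarrow> \<exists>n. V7 b (a \<cdot> ipow S m e x n)"
    using extend_by_power[OF V7(1)] by blast
  interpret V8: loop_congruence S m e V8 by (rule V8(1))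
  \<comment> \<open>The kernel of the last congruence contains both generators, so it is all of
    \<open>S\<close>.\<close>
  have "subloop S m e {a \<in> S. V8 e a}"
  proof (rule subloopI)
    show "a \<cdot> b \<in> {a \<in> S. V8 e a}" if "a \<in> {a \<in> S. V8 e a}" "b \<in> {a \<in> S. V8 e a}" for a b
      using that V8.R_mult[of e a e b] by simp
    show "b \<in> {a \<in> S. V8 e a}" if "a \<in> {a \<in> S. V8 e a}" "b \<in> S" "a \<cdot> b \<in> {a \<in> S. V8 e a}" for a b
      using that V8.R_cancel_mult[of e e a b] by simp
  qed auto
  from generated[OF this] have "V8 e s"
    using V8(3) V8(2)[OF V7(3)] s x y by blast
  then obtain n1 where "V7 s (e \<cdot> ipow S m e x n1)" using V8(4) by blast
  then have "V7 (ipow S m e x n1) s" using loop_congruence.R_sym[OF V7(1)] by simp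
  then obtain n2 where "V6 s (ipow S m e x n1 \<cdot> ipow S m e y n2)" using V7(4) by blast
  then obtain n3 where "V5 s ((ipow S m e x n1 \<cdot> ipow S m e y n2) \<cdot> ipow S m e u1 n3)"
    using V6.R_sym V6(4) loop_congruence.R_sym[OF V5(1)] by blast
  then obtain n4 where "V4 s (((ipow S m e x n1 \<cdot> ipow S m e y n2) \<cdot> ipow S m e u1 n3) \<cdot> ipow S m e u2 n4)"
    using loop_congruence.R_sym[OF V5(1)] V5(4) by blast
  \<comment> \<open>The powers of \<open>u1\<close> and \<open>u2\<close> must be regrouped here:
    \<open>u1\<close> is central only modulo \<open>V4\<close>, so this has to precede the passage
    to the finer congruences.\<close>
  moreover have "V4 (((ipow S m e x n1 \<cdot> ipow S m e y n2) \<cdot> ipow S m e u1 n3) \<cdot> ipow S m e u2 n4)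
      ((ipow S m e x n1 \<cdot> ipow S m e y n2) \<cdot> (ipow S m e u1 n3 \<cdot> ipow S m e u2 n4))" (is "V4 _ ?p")
    using V4.nucleus_mid[OF V4.ipow_nucleus[OF u1V4]] u by simp
  ultimately have "V4 ?p s" using V4.R_trans V4.R_sym by blast
  then obtain n5 where "V3 (?p \<cdot> ipow S m e v1 n5) s" using V4(4) loop_congruence.R_sym[OF V3(1)] by blast
  then obtain n6 where "V2 ((?p \<cdot> ipow S m e v1 n5) \<cdot> ipow S m e v2 n6) s"
    using V3(4) loop_congruence.R_sym[OF V2(1)] by blast
  then obtain n7 where "V1 (((?p \<cdot> ipow S m e v1 n5) \<cdot> ipow S m e v2 n6) \<cdot> ipow S m e v3 n7) s"
    using V2(4) loop_congruence.R_sym[OF V1(1)] by blast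
  then obtain n8 where "s = (((?p \<cdot> ipow S m e v1 n5) \<cdot> ipow S m e v2 n6) \<cdot> ipow S m e v3 n7) \<cdot> ipow S m e v4 n8"
    using V1(4) unfolding eq_on_def by blast
  then show ?thesis by blast
qed

end

theorem theorem5p4:
  fixes S :: "'a set" and m :: "'a \<Rightarrow> 'a \<Rightarrow> 'a" and e x y :: 'a
  assumes free: "free_CAL3 S m e x y"
  defines "u1 \<equiv> associator S m x x y"
      and "u2 \<equiv> associator S m x y y"
  defines "v1 \<equiv> associator S m x x u1"
      and "v2 \<equiv> associator S m x x u2"
      and "v3 \<equiv> associator S m y y u1"
      and "v4 \<equiv> associator S m y y u2"
  defines "nf \<equiv> (\<lambda>a :: int list.
     m (m (m (m (m (m (ipow S m e x (a!0)) (ipow S m e y (a!1)))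
                      (m (ipow S m e u1 (a!2)) (ipow S m e u2 (a!3))))
                (ipow S m e v1 (a!4)))
             (ipow S m e v2 (a!5)))
          (ipow S m e v3 (a!6)))
       (ipow S m e v4 (a!7)))"
  shows "bij_betw nf Z8 S \<and>
         (\<exists>\<phi>. bij_betw \<phi> Z8 S \<and> (\<forall>a\<in>Z8. \<forall>b\<in>Z8. \<phi> (star a b) = m (\<phi> a) (\<phi> b)))"
proof -
  have CAL3: "CAL3 S m e" and xy: "x \<in> S" "y \<in> S"
    and gen: "\<And>T. subloop S m e T \<Longrightarrow> x \<in> T \<Longrightarrow> y \<in> T \<Longrightarrow> S \<subseteq> T"
    and ext: "\<And>(T :: int list set) n u a b. CAL3 T n u \<Longrightarrow> a \<in> T \<Longrightarrow> b \<in> T \<Longrightarrow>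
      \<exists>h. loop_hom S m T n h \<and> h x = a \<and> h y = b"
    using free unfolding free_CAL3_def by simp_all
  interpret comm_loop S m e
    using CAL3 by unfold_locales (simp add: CAL3_def)
  interpret cal3_generated S m e x y
  proof
    show lam_hom using CAL3 automorphic_imp_lam_hom by (simp add: CAL3_def)
    show "loop_congruence.nucleus S m R2 = S"
      using CAL3 nilpotency_class_le_3 unfolding CAL3_def by blast
    show "x \<in> S" "y \<in> S" by (rule xy)+
    show "S \<subseteq> T" if "subloop S m e T" "x \<in> T" "y \<in> T" for T
      using gen[OF that] .
  qed
  \<comment> \<open>The carrier \<open>Z8\<close> lies in \<open>int list\<close>, the type over
    which freeness quantifies.\<close>
  have "\<exists>h. loop_hom S m Z8 star h \<and> h x = [1,0,0,0,0,0,0,0] \<and> h y = [0,1,0,0,0,0,0,0]"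
    by (rule ext[OF CAL3_Z8 Z8_Cons Z8_Cons])
  then obtain h where h: "loop_hom S m Z8 star h" "h x = [1,0,0,0,0,0,0,0]" "h y = [0,1,0,0,0,0,0,0]"
    by blast
  interpret h: comm_loop_hom S m e Z8 star zero8 h
    by unfold_locales (rule h(1))
  have uS: "u1 \<in> S" "u2 \<in> S" using xy by (simp_all add: u1_def u2_def)
  then have vS: "v1 \<in> S" "v2 \<in> S" "v3 \<in> S" "v4 \<in> S"
    using xy by (simp_all add: v1_def v2_def v3_def v4_def)
  have hu: "h u1 = [0,0,1,0,0,0,0,0]" "h u2 = [0,0,0,1,0,0,0,0]"
    unfolding u1_def u2_def using xy h by (simp_all add: h.hom_associator Z8_associators)
  have hv: "h v1 = [0,0,0,0,1,0,0,0]" "h v2 = [0,0,0,0,0,1,0,0]"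
      "h v3 = [0,0,0,0,0,0,1,0]" "h v4 = [0,0,0,0,0,0,0,1]"
    unfolding v1_def v2_def v3_def v4_def using xy uS h hu by (simp_all add: h.hom_associator Z8_associators)
  have nfS: "nf a \<in> S" for a
    unfolding nf_def using xy uS vS by simp
  \<comment> \<open>A left inverse of \<open>nf\<close>, which gives uniqueness of the
    exponents.\<close>
  have h_nf: "h (nf a) = a" if "a \<in> Z8" for a
    using that xy uS vS
    by (elim Z8_cases) (simp add: nf_def h.hom_ipow h hu hv Z8_ipow star_Cons)
  have nf_surj: "\<exists>a\<in>Z8. nf a = s" if s: "s \<in> S" for s
  proof -
    obtain n1 n2 n3 n4 n5 n6 n7 n8 where "s = nf [n1,n2,n3,n4,n5,n6,n7,n8]"
      using normal_form[OF s] unfolding nf_def u1_def u2_def v1_def v2_def v3_def v4_def by auto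
    then show ?thesis by (intro bexI) auto
  qed
  have bij: "bij_betw nf Z8 S"
    using nfS nf_surj h_nf by (intro bij_betwI[where g = h]) (metis Pi_I h.hom_in)+
  \<comment> \<open>The normal form map itself is the isomorphism: applying \<open>h\<close> to the
    normal form of a product identifies its exponents.\<close>
  have "nf (star a b) = m (nf a) (nf b)" if "a \<in> Z8" "b \<in> Z8" for a b
  proof -
    obtain c where c: "c \<in> Z8" "nf c = m (nf a) (nf b)" using nf_surj nfS by blast
    have "c = h (m (nf a) (nf b))" using h_nf c by metis
    also have "\<dots> = star a b" using nfS h_nf that by simp
    finally show ?thesis using c by simp
  qed
  then show ?thesis using bij by blast
qed

end
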